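(* Fix $\epsilon_0\in(0,1/2)$, $u_0\in\mathbb{R}$, $A>0$, $\sigma_0^2\in(0,A)$, $\gamma\in(0,1/A)$, and a sequence of positive numbers $b_n$ with $\lim_{n\to\infty}b_n=0$. Let $t_n=t_n(\gamma)=\sqrt{\gamma\log n}$. Consider a sequence of parameters $\epsilon_n\in(0,\epsilon_0]$ and a sequence of bivariate distributions $H_n(u,\sigma)$ such that for all sufficiently large $n$, $P_{H_n}(u>u_0,\ \sigma^2\le A)=1$ and $\epsilon_n^{-2}n^{A\gamma-1}\le b_n$. Suppose also that, as $n\to\infty$, at least one of the following two conditions holds: (b) $P_{H_n}(u>u_0+\delta_n)=1$, where $\delta_n>0$ satisfies, for some constant $c_0>1$, $$\liminf_{n\to\infty}\Big\{\frac{\delta_n t_n}{\sqrt2\,\log(t_n)}\Big\}\ge c_0+1;$$ (c) under $H_n$ the pair $(\delta,\kappa)=(u-u_0,(\sigma^2-\sigma_0^2)/2)$ has a joint density, and for some constants $\alpha>0$ and $C>0$, for all $\delta$ in the range and all real $t$, $$|h_n^{FT}(t\mid\delta)|\le C(1+|t|)^{-\alpha},\qquad \Big|\frac{d}{dt}h_n^{FT}(t\mid\delta)\Big|\le C(1+|t|)^{-(\alpha+1)}.$$ Let $\hat u_0(\gamma)=u_0(\varphi_n;t_n(\gamma))$ and $\hat\sigma_0^2(\gamma)=\sigma_0^2(\varphi_n;t_n(\gamma))$. Then, as $n\to\infty$, except for a probability that tends to zero, $$\Big|\frac{\epsilon_n(\varphi_n;t_n(\gamma),\hat u_0(\gamma),\hat\sigma_0^2(\gamma))}{\epsilon_n}-1\Big|\to0,$$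 uniformly for all $\epsilon_n$ and $H_n$ satisfying the conditions above. Precisely: for a fixed sequence $\delta_n$ as in (b) and fixed constants $\alpha,C>0$, let $\mathcal{C}_n$ be the set of pairs $(\epsilon_n,H_n)$ with $\epsilon_n\in(0,\epsilon_0]$, $P_{H_n}(u>u_0,\sigma^2\le A)=1$, $\epsilon_n^{-2}n^{A\gamma-1}\le b_n$, and either $P_{H_n}(u>u_0+\delta_n)=1$ or the bounds in (c) with these $\alpha,C$. Then for every $\eta>0$, $$\lim_{n\to\infty}\ \sup_{(\epsilon_n,H_n)\in\mathcal{C}_n}P\Big(\Big|\frac{\epsilon_n(\varphi_n;t_n(\gamma),\hat u_0(\gamma),\hat\sigma_0^2(\gamma))}{\epsilon_n}-1\Big|>\eta\Big)=0 .$$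
   Context: $\phi$ is the $N(0,1)$ density, $i=\sqrt{-1}$, $\omega=-(1+i)/\sqrt2$ (so $\omega^2=i$). For each $n$, $X_1,\dots,X_n$ are i.i.d. with density $$f(x)=(1-\epsilon_n)\frac1{\sigma_0}\phi\Big(\frac{x-u_0}{\sigma_0}\Big)+\epsilon_n\int\frac1\sigma\phi\Big(\frac{x-u}{\sigma}\Big)dH_n(u,\sigma),$$ where $\sigma_0>0$ and $H_n$ is a probability distribution of $(u,\sigma)\in\mathbb{R}\times(0,\infty)$; $P_{H_n}$ is probability under $H_n$, and $P$ is probability for the sample $X_1,\dots,X_n$ (with parameters $\epsilon_n,H_n$). The generalized empirical characteristic function is $\varphi_n(t)=\frac1n\sum_{j=1}^n\exp(\omega tX_j)$. For a differentiable complex-valued function $g$ of a real variable, and $t>0$ with $g(t)\ne0$, $$u_0(g;t)=-\frac{\sqrt2}{|g(t)|}\frac{d}{dt}|g(t)|,\qquad \sigma_0^2(g;t)=\frac{\sqrt2\,\mathrm{Re}\big(\omega\,\overline{g(t)}\,g'(t)\big)}{t\,|g(t)|^2}.$$ (On the event $\varphi_n(t)=0$ the estimators may be given arbitrary values.) For a complex-valued function $g$ and real $t$, $u$, $s$, define the (complex-valued) functional $$\epsilon_n(g;t,u,s)=1-e^{-\omega ut-ist^2/2}\,g(t).$$ In (c), $h_n(\kappa\mid\delta)$ is the conditional density of $\kappa$ given $\delta$ when $(u,\sigma)\sim H_n$, and $h_n^{FT}(t\mid\delta)=\int e^{it\kappa}h_n(\kappa\mid\delta)\,d\kappa$ is its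 Fourier transform. *)

theory Defs
  imports "HOL-Probability.Probability"
begin

definition omega :: complex where
  "omega = - (1 + \<i>) / complex_of_real (sqrt 2)"

text \<open>The mixing integral is an \<open>ennreal\<close>-valued integral, since
  \<open>\<integral> \<phi>((x - u) / \<sigma>) / \<sigma> dH(u,\<sigma>)\<close> may be infinite for exceptional \<open>x\<close>.\<close>

definition mix_density ::
  "real \<Rightarrow> real \<Rightarrow> real \<Rightarrow> (real \<times> real) measure \<Rightarrow> real \<Rightarrow> ennreal" where
  "mix_density u0 \<sigma>0 \<epsilon> H x =
     ennreal ((1 - \<epsilon>) * normal_density u0 \<sigma>0 x)
     + ennreal \<epsilon> * (\<integral>\<^sup>+ p. ennreal (normal_density (fst p) (snd p) x) \<partial>H)"

text \<open>Joint law of the sample \<open>X\<^sub>1, \<dots>, X\<^sub>n\<close>.\<close>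

definition sample_law ::
  "real \<Rightarrow> real \<Rightarrow> nat \<Rightarrow> real \<Rightarrow> (real \<times> real) measure \<Rightarrow> (nat \<Rightarrow> real) measure" where
  "sample_law u0 \<sigma>0 n \<epsilon> H =
     (\<Pi>\<^sub>M j\<in>{1..n}. density lborel (mix_density u0 \<sigma>0 \<epsilon> H))"

definition gen_ecf :: "nat \<Rightarrow> (nat \<Rightarrow> real) \<Rightarrow> real \<Rightarrow> complex" where
  "gen_ecf n x t = (\<Sum>j=1..n. exp (omega * of_real t * of_real (x j))) / of_nat n"

definition u0_fun :: "(real \<Rightarrow> complex) \<Rightarrow> real \<Rightarrow> real" where
  "u0_fun g t = - (sqrt 2 / cmod (g t)) * deriv (\<lambda>s. cmod (g s)) t"

definition sigma0sq_fun :: "(real \<Rightarrow> complex) \<Rightarrow> real \<Rightarrow> real" where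
  "sigma0sq_fun g t =
     sqrt 2 * Re (omega * cnj (g t) * vector_derivative g (at t)) / (t * (cmod (g t))\<^sup>2)"

definition eps_fun :: "(real \<Rightarrow> complex) \<Rightarrow> real \<Rightarrow> real \<Rightarrow> real \<Rightarrow> complex" where
  "eps_fun g t u s =
     1 - exp (- omega * of_real u * of_real t - \<i> * of_real s * (of_real t)\<^sup>2 / 2) * g t"

definition freq :: "real \<Rightarrow> nat \<Rightarrow> real" where
  "freq \<gamma> n = sqrt (\<gamma> * ln (real n))"

definition mixing_distribution :: "(real \<times> real) measure \<Rightarrow> bool" where
  "mixing_distribution H \<longleftrightarrow>
     prob_space H \<and> sets H = sets borel \<and> (AE p in H. 0 < snd p)"

definition marginal_density :: "(real \<times> real \<Rightarrow> real) \<Rightarrow> real \<Rightarrow> real" where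
  "marginal_density f \<delta> = (LINT \<kappa>|lborel. f (\<delta>, \<kappa>))"

definition cond_density :: "(real \<times> real \<Rightarrow> real) \<Rightarrow> real \<Rightarrow> real \<Rightarrow> real" where
  "cond_density f \<delta> \<kappa> = f (\<delta>, \<kappa>) / marginal_density f \<delta>"

definition cond_FT :: "(real \<times> real \<Rightarrow> real) \<Rightarrow> real \<Rightarrow> real \<Rightarrow> complex" where
  "cond_FT f \<delta> t = (CLINT \<kappa>|lborel. iexp (t * \<kappa>) * of_real (cond_density f \<delta> \<kappa>))"

text \<open>A joint density is determined only up to null sets; it suffices that some version \<open>f\<close>
  satisfies the bounds. The range of \<open>\<delta>\<close> is where the marginal density of that version is
  positive (the Bochner integral is 0 on the null set where \<open>f (\<delta>, \<cdot>)\<close> is not integrable).\<close>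

definition smooth_mixing ::
  "real \<Rightarrow> real \<Rightarrow> real \<Rightarrow> real \<Rightarrow> (real \<times> real) measure \<Rightarrow> bool" where
  "smooth_mixing u0 \<sigma>0 \<alpha> C H \<longleftrightarrow>
     (\<exists>f. f \<in> borel_measurable (lborel \<Otimes>\<^sub>M lborel) \<and> (\<forall>p. 0 \<le> f p) \<and>
        distributed H (lborel \<Otimes>\<^sub>M lborel)
          (\<lambda>(u, \<sigma>). (u - u0, (\<sigma>\<^sup>2 - \<sigma>0\<^sup>2) / 2)) (\<lambda>p. ennreal (f p)) \<and>
        (\<forall>\<delta>. 0 < marginal_density f \<delta> \<longrightarrow>
           (\<forall>t. cmod (cond_FT f \<delta> t) \<le> C * (1 + \<bar>t\<bar>) powr (- \<alpha>) \<and>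
                (\<exists>D. (cond_FT f \<delta> has_vector_derivative D) (at t) \<and>
                     cmod D \<le> C * (1 + \<bar>t\<bar>) powr (- (\<alpha> + 1))))))"

definition param_class ::
  "real \<Rightarrow> real \<Rightarrow> real \<Rightarrow> real \<Rightarrow> real \<Rightarrow> (nat \<Rightarrow> real) \<Rightarrow> (nat \<Rightarrow> real) \<Rightarrow> real \<Rightarrow> real
    \<Rightarrow> nat \<Rightarrow> (real \<times> (real \<times> real) measure) set" where
  "param_class \<epsilon>0 u0 A \<sigma>0 \<gamma> b \<delta> \<alpha> C n =
     {(\<epsilon>, H). 0 < \<epsilon> \<and> \<epsilon> \<le> \<epsilon>0 \<and> mixing_distribution H \<and>
        \<P>(p in H. fst p > u0 \<and> (snd p)\<^sup>2 \<le> A) = 1 \<and>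
        real n powr (A * \<gamma> - 1) / \<epsilon>\<^sup>2 \<le> b n \<and>
        (\<P>(p in H. fst p > u0 + \<delta> n) = 1 \<or> smooth_mixing u0 \<sigma>0 \<alpha> C H)}"

end

theory Submission
  imports Defs "HOL-Real_Asymp.Real_Asymp"
begin

text \<open>Divide the empirical transform \<open>\<phi>\<^sub>n(t)\<close> by the transform \<open>ref_cf\<close> of the null component
\<open>N(u0, \<sigma>0\<^sup>2)\<close> and call the quotient \<open>G\<close>. The functionals \<open>u0_fun\<close> and \<open>sigma0sq_fun\<close> depend on the
logarithmic derivative of \<open>\<phi>\<^sub>n\<close> only, and their errors are linear in \<open>G'/G\<close>
(\<open>estimator_functionals\<close>). Substituting them gives \<open>eps_fun = 1 - exp(z) G\<close> with
\<open>\<bar>z\<bar> \<le> 2t\<bar>G'/G\<bar>\<close>. Hence the estimator is consistent relative to \<open>\<epsilon>\<close> as soon as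
\<open>G = 1 - \<epsilon> + o(\<epsilon>)\<close> and \<open>tG' = o(\<epsilon>)\<close> (\<open>eps_estimate_deterministic\<close>).

Bias. The mean of \<open>G\<close> is \<open>1 - \<epsilon> + \<epsilon>m(t)\<close> and that of \<open>G'\<close> is \<open>\<epsilon>m'(t)\<close>, where
\<open>m(t) = \<integral> exp(\<omega>t\<delta> + it\<^sup>2\<kappa>) dH\<close> with \<open>\<delta> = u - u0\<close> and \<open>\<kappa> = (\<sigma>\<^sup>2 - \<sigma>0\<^sup>2)/2\<close>. So \<open>m\<close> and \<open>tm'\<close>
must vanish in the limit. If the shifts are separated from zero, the modulus \<open>exp(-t\<delta>/\<surd>2)\<close> is
small (\<open>separated_mix_terms\<close>). If the conditional law of \<open>\<kappa>\<close> is smooth, its Fourier transform at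
\<open>t\<^sup>2\<close> is small (\<open>smooth_mix_terms\<close>).

Noise. By Chebyshev (\<open>chebyshev_sample_mean\<close>) it suffices that the second moments, divided by
\<open>n\<epsilon>\<^sup>2\<close>, tend to zero even after multiplication by \<open>t\<^sup>2\<close>. A component with variance \<open>\<sigma>\<^sup>2\<close>
has second moment about \<open>exp(t\<^sup>2\<sigma>\<^sup>2) = n\<^bsup>\<gamma>\<sigma>\<^sup>2\<^esup>\<close>. Bounding every variance by \<open>A\<close> would give
\<open>n\<^bsup>A\<gamma>-1\<^esup>/\<epsilon>\<^sup>2 \<le> b\<^sub>n\<close>, and \<open>b\<^sub>n\<close> may decay too slowly to absorb powers of \<open>t\<close>. But the
variance \<open>A\<close> occurs only with weight \<open>\<epsilon>\<close>, so the relevant quantities are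
\<open>n\<^bsup>\<gamma>\<sigma>0\<^sup>2-1\<^esup>/\<epsilon>\<^sup>2\<close> and \<open>n\<^bsup>A\<gamma>-1\<^esup>/\<epsilon>\<close>. Both are bounded by negative powers of \<open>n\<close>, because
\<open>\<sigma>0\<^sup>2 < A\<close> and \<open>A\<gamma> < 1\<close> (\<open>moment_bound_ratio_le\<close>), and these beat every factor \<open>exp(O(t))\<close>. All
bounds depend on \<open>(\<epsilon>, H)\<close> only through the constants of the parameter class, which gives
uniformity.\<close>

section \<open>Fourier and Gaussian integrals\<close>

text \<open>The second-order Taylor estimate \<open>\<bar>e\<^bsup>iy\<^esup> - 1 - iy\<bar> \<le> y\<^sup>2/2\<close> bounds the error of
the linear approximation by \<open>h\<^sup>2/2\<close> times the second absolute moment of \<open>f\<close>. The lemma serves two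
densities: the standard normal one, and the conditional density of the variance shift, for whose
transform the hypotheses bound the derivative.\<close>

lemma fourier_integral_has_vector_derivative:
  fixes f :: "real \<Rightarrow> real"
  assumes f: "integrable lborel f" and f2: "integrable lborel (\<lambda>x. x\<^sup>2 * f x)"
  shows "integrable lborel (\<lambda>x. \<i> * of_real x * iexp (t * x) * of_real (f x))"
    and "((\<lambda>t. CLINT x|lborel. iexp (t * x) * of_real (f x)) has_vector_derivative
           (CLINT x|lborel. \<i> * of_real x * iexp (t * x) * of_real (f x))) (at t)"
proof -
  have [measurable]: "f \<in> borel_measurable lborel" using f by auto
  have int0: "integrable lborel (\<lambda>x. iexp (s * x) * of_real (f x))" for s
    by (rule Bochner_Integration.integrable_bound[OF f]) (auto simp: norm_mult)
  have int1: "integrable lborel (\<lambda>x. \<i> * of_real x * iexp (s * x) * of_real (f x))" for s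
  proof (rule Bochner_Integration.integrable_bound[OF Bochner_Integration.integrable_add[OF f[THEN integrable_abs] f2[THEN integrable_abs]]])
    have *: "\<bar>x\<bar> * \<bar>y\<bar> \<le> \<bar>\<bar>y\<bar> + \<bar>x\<^sup>2 * y\<bar>\<bar>" for x y :: real
    proof -
      have "\<bar>x\<bar> \<le> 1 + x\<^sup>2"
        using zero_le_power2[of "\<bar>x\<bar> - 1"] zero_le_power2[of x] by (simp add: power2_diff del: zero_le_power2)
      then have "\<bar>x\<bar> * \<bar>y\<bar> \<le> (1 + x\<^sup>2) * \<bar>y\<bar>" by (intro mult_right_mono) auto
      then show ?thesis by (simp add: abs_mult algebra_simps)
    qed
    then show "AE x in lborel. norm (\<i> * of_real x * iexp (s * x) * of_real (f x)) \<le> norm (\<bar>f x\<bar> + \<bar>x\<^sup>2 * f x\<bar>)"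
      by (intro AE_I2) (simp add: norm_mult)
  qed simp
  show "integrable lborel (\<lambda>x. \<i> * of_real x * iexp (t * x) * of_real (f x))" by (rule int1)
  define F where "F = (\<lambda>t. CLINT x|lborel. iexp (t * x) * of_real (f x))"
  define D where "D = (CLINT x|lborel. \<i> * of_real x * iexp (t * x) * of_real (f x))"
  define K where "K = (LINT x|lborel. \<bar>x\<^sup>2 * f x\<bar>) / 2"
  have bound: "cmod (F s - F t - (s - t) *\<^sub>R D) \<le> (s - t)\<^sup>2 * K" for s
  proof -
    define h where "h = s - t"
    let ?G = "\<lambda>x. iexp (t * x) * (iexp (h * x) - 1 - \<i> * of_real (h * x)) * of_real (f x)"
    have eq: "?G = (\<lambda>x. iexp (s * x) * of_real (f x) - iexp (t * x) * of_real (f x) - h *\<^sub>R (\<i> * of_real x * iexp (t * x) * of_real (f x)))"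
    proof
      fix x
      have "iexp (s * x) = iexp (t * x) * iexp (h * x)"
        by (simp add: h_def exp_add[symmetric] algebra_simps)
      then show "?G x = iexp (s * x) * of_real (f x) - iexp (t * x) * of_real (f x) - h *\<^sub>R (\<i> * of_real x * iexp (t * x) * of_real (f x))"
        by (simp add: scaleR_conv_of_real algebra_simps)
    qed
    have Gint: "integrable lborel ?G"
      unfolding eq by (intro Bochner_Integration.integrable_diff integrable_scaleR_right int0 int1)
    have "F s - F t - h *\<^sub>R D = (CLINT x|lborel. ?G x)"
      unfolding eq F_def D_def
      by (subst Bochner_Integration.integral_diff Bochner_Integration.integral_scaleR_right; (intro Bochner_Integration.integrable_diff integrable_scaleR_right int0 int1)?)+ (rule refl)
    also have "cmod \<dots> \<le> (LINT x|lborel. cmod (?G x))" by (rule integral_norm_bound)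
    also have "\<dots> \<le> (LINT x|lborel. h\<^sup>2 / 2 * \<bar>x\<^sup>2 * f x\<bar>)"
    proof (rule integral_mono)
      show "integrable lborel (\<lambda>x. cmod (?G x))"
        by (rule integrable_norm[OF Gint])
      show "integrable lborel (\<lambda>x. h\<^sup>2 / 2 * \<bar>x\<^sup>2 * f x\<bar>)" using f2 by (intro integrable_mult_right integrable_abs)
      fix x
      have "cmod (iexp (h * x) - 1 - \<i> * of_real (h * x)) \<le> (h*x)\<^sup>2 / 2"
        using iexp_approx1[of "h * x" 1] by (simp add: power2_eq_square diff_diff_eq numeral_2_eq_2 abs_mult[symmetric])
      then have "cmod (iexp (h * x) - 1 - \<i> * of_real (h * x)) * \<bar>f x\<bar> \<le> (h*x)\<^sup>2 / 2 * \<bar>f x\<bar>"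
        by (intro mult_right_mono) auto
      then show "cmod (?G x) \<le> h\<^sup>2 / 2 * \<bar>x\<^sup>2 * f x\<bar>"
        by (simp add: norm_mult abs_mult power_mult_distrib)
    qed
    also have "\<dots> = h\<^sup>2 * K" by (simp add: K_def)
    finally show ?thesis by (simp add: h_def)
  qed
  have "(F has_vector_derivative D) (at t)"
    unfolding has_vector_derivative_def has_derivative_at2
  proof (intro conjI)
    show "bounded_linear (\<lambda>x. x *\<^sub>R D)" by (rule bounded_linear_scaleR_left)
    have "((\<lambda>y. \<bar>y - t\<bar> * K) \<longlongrightarrow> 0) (at t)"
      by (rule tendsto_eq_intros | simp)+
    then show "((\<lambda>y. (1 / norm (y - t)) *\<^sub>R (F y - (F t + (y - t) *\<^sub>R D))) \<longlongrightarrow> 0) (at t)"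
    proof (rule Lim_null_comparison[rotated])
      show "\<forall>\<^sub>F y in at t. norm ((1 / norm (y - t)) *\<^sub>R (F y - (F t + (y - t) *\<^sub>R D))) \<le> \<bar>y - t\<bar> * K"
        unfolding eventually_at_filter
      proof (intro always_eventually allI impI)
        fix y assume "y \<noteq> t"
        then show "norm ((1 / norm (y - t)) *\<^sub>R (F y - (F t + (y - t) *\<^sub>R D))) \<le> \<bar>y - t\<bar> * K"
          using bound[of y] unfolding norm_scaleR
          by (simp add: divide_le_eq diff_diff_eq power2_eq_square mult.assoc mult.left_commute mult.commute abs_mult_self_eq flip: abs_mult)
      qed
    qed
  qed
  then show "((\<lambda>t. CLINT x|lborel. iexp (t * x) * of_real (f x)) has_vector_derivative
           (CLINT x|lborel. \<i> * of_real x * iexp (t * x) * of_real (f x))) (at t)"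
    by (simp add: F_def D_def)
qed

lemma std_normal_fourier:
  "(CLINT x|lborel. iexp (b * x) * of_real (std_normal_density x)) = exp (- (of_real b)\<^sup>2 / 2)"
proof -
  have "char std_normal_distribution b = (CLINT x|lborel. iexp (b * x) * of_real (std_normal_density x))"
    by (simp add: char_def integral_density scaleR_conv_of_real mult.commute)
  then show ?thesis
    by (simp add: char_std_normal_distribution exp_of_real[symmetric])
qed

lemma std_normal_fourier_deriv:
  "integrable lborel (\<lambda>x. of_real x * iexp (b * x) * of_real (std_normal_density x))"
  "(CLINT x|lborel. of_real x * iexp (b * x) * of_real (std_normal_density x)) = \<i> * of_real b * exp (- (of_real b)\<^sup>2 / 2)"
proof -
  have "integrable lborel (\<lambda>x. x\<^sup>2 * std_normal_density x)"
    using integrable_std_normal_moment[of 2] by (simp add: mult.commute)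
  note D = fourier_integral_has_vector_derivative[OF integrable_normal_density this, of b]
  let ?I = "CLINT x|lborel. of_real x * iexp (b * x) * of_real (std_normal_density x)"
  have i: "integrable lborel (\<lambda>x. \<i> * (of_real x * iexp (b * x) * of_real (std_normal_density x)))"
    using D(1) by (simp add: mult.assoc)
  then show "integrable lborel (\<lambda>x. of_real x * iexp (b * x) * of_real (std_normal_density x))"
    using integrable_mult_right[of "-\<i>", OF i] by (simp add: mult.assoc[symmetric])
  have "((\<lambda>t. exp (- (of_real t)\<^sup>2 / 2)) has_vector_derivative \<i> * ?I) (at b)"
    using D(2) unfolding std_normal_fourier by (simp add: mult.assoc)
  moreover have "((\<lambda>t. exp (- (of_real t)\<^sup>2 / 2) :: complex) has_vector_derivative - of_real b * exp (- (of_real b)\<^sup>2 / 2)) (at b)"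
    by (auto intro!: derivative_eq_intros has_vector_derivative_real_field)
  ultimately have "\<i> * ?I = - of_real b * exp (- (of_real b)\<^sup>2 / 2)"
    by (rule vector_derivative_unique_at)
  then have "- \<i> * (\<i> * ?I) = - \<i> * (- of_real b * exp (- (of_real b)\<^sup>2 / 2))" by simp
  then show "?I = \<i> * of_real b * exp (- (of_real b)\<^sup>2 / 2)" by (simp add: mult.assoc[symmetric])
qed

text \<open>For \<open>c = a + ib\<close>, translating by \<open>a\<close> absorbs the real exponential into the Gaussian:
\<open>e\<^bsup>ax\<^esup>\<phi>(x) = e\<^bsup>a\<^sup>2/2\<^esup>\<phi>(x - a)\<close>. This reduces a complex argument to the characteristic
function and its derivative.\<close>

lemma std_normal_complex_mgf:
  fixes c :: complex
  shows "integrable std_normal_distribution (\<lambda>x. exp (c * of_real x))"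
    and "(CLINT x|std_normal_distribution. exp (c * of_real x)) = exp (c\<^sup>2 / 2)"
    and "integrable std_normal_distribution (\<lambda>x. of_real x * exp (c * of_real x))"
    and "(CLINT x|std_normal_distribution. of_real x * exp (c * of_real x)) = c * exp (c\<^sup>2 / 2)"
proof -
  define a b where "a = Re c" and "b = Im c"
  have c: "c = of_real a + \<i> * of_real b" by (simp add: a_def b_def complex_eq)
  define K where "K = exp (of_real (a\<^sup>2 / 2) + \<i> * of_real (a * b))"
  have shift: "std_normal_density (a + 1 * x) *\<^sub>R exp (c * of_real (a + 1 * x)) = K * (iexp (b * x) * of_real (std_normal_density x))" for x
  proof -
    have "of_real (exp (- (a + x)\<^sup>2 / 2)) * exp (c * of_real (a + x))
        = K * (iexp (b * x) * of_real (exp (- x\<^sup>2 / 2)))"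
      unfolding K_def c exp_of_real[symmetric] exp_add[symmetric]
      by (rule arg_cong[where f=exp]) (simp add: field_simps power2_eq_square)
    then show ?thesis by (simp add: std_normal_density_def scaleR_conv_of_real field_simps)
  qed
  have Kc: "K * exp (- (of_real b)\<^sup>2 / 2) = exp (c\<^sup>2 / 2)"
    unfolding K_def c exp_add[symmetric]
    by (rule arg_cong[where f=exp]) (simp add: field_simps power2_eq_square)
  have shift1: "std_normal_density (a + 1 * x) *\<^sub>R (of_real (a + 1 * x) * exp (c * of_real (a + 1 * x)))
     = K * (a * (iexp (b * x) * of_real (std_normal_density x)) + of_real x * iexp (b * x) * of_real (std_normal_density x))" for x
  proof -
    have "std_normal_density (a + 1 * x) *\<^sub>R (of_real (a + 1 * x) * exp (c * of_real (a + 1 * x)))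
      = of_real (a + x) * (std_normal_density (a + 1 * x) *\<^sub>R exp (c * of_real (a + 1 * x)))" by simp
    then show ?thesis unfolding shift by (simp add: algebra_simps)
  qed
  have i0: "integrable lborel (\<lambda>x. iexp (b * x) * of_real (std_normal_density x))"
    by (rule Bochner_Integration.integrable_bound[OF integrable_normal_density[of 1 0, OF zero_less_one]]) (auto simp: norm_mult)
  note i1 = std_normal_fourier_deriv(1)[of b]
  show "integrable std_normal_distribution (\<lambda>x. exp (c * of_real x))"
    apply (subst integrable_density; simp?)
    apply (subst lborel_integrable_real_affine_iff[of 1 _ a, symmetric], simp)
    unfolding shift using i0 by simp
  show "(CLINT x|std_normal_distribution. exp (c * of_real x)) = exp (c\<^sup>2 / 2)"
    apply (subst integral_density; simp?)
    apply (subst lborel_integral_real_affine[of 1 _ a], simp)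
    unfolding shift using i0 by (simp add: std_normal_fourier Kc[simplified] del: of_real_mult)
  show "integrable std_normal_distribution (\<lambda>x. of_real x * exp (c * of_real x))"
    apply (subst integrable_density; simp?)
    apply (subst lborel_integrable_real_affine_iff[of 1 _ a, symmetric], simp)
    unfolding shift1 using i0 i1 by (simp del: of_real_mult)
  have "(CLINT x|std_normal_distribution. of_real x * exp (c * of_real x)) = K * (of_real a * exp (- (of_real b)\<^sup>2 / 2) + \<i> * of_real b * exp (- (of_real b)\<^sup>2 / 2))"
    apply (subst integral_density; simp?)
    apply (subst lborel_integral_real_affine[of 1 _ a], simp)
    unfolding shift1 using i0 i1 by (simp add: std_normal_fourier std_normal_fourier_deriv(2) del: of_real_mult)
  also have "\<dots> = c * (K * exp (- (of_real b)\<^sup>2 / 2))" by (simp add: c algebra_simps)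
  finally show "(CLINT x|std_normal_distribution. of_real x * exp (c * of_real x)) = c * exp (c\<^sup>2 / 2)"
    unfolding Kc .
qed

lemma std_normal_real_mgf:
  fixes s :: real
  shows "(\<integral>\<^sup>+ x. ennreal (exp (s * x)) \<partial>std_normal_distribution) = ennreal (exp (s\<^sup>2 / 2))"
proof -
  have I: "integrable std_normal_distribution (\<lambda>x. complex_of_real (exp (s * x)))"
    using std_normal_complex_mgf(1)[of "of_real s"] by (simp add: exp_of_real[symmetric])
  then have I': "integrable std_normal_distribution (\<lambda>x. exp (s * x))"
    by (simp add: complex_of_real_integrable_eq)
  have "complex_of_real (LINT x|std_normal_distribution. exp (s * x)) = (CLINT x|std_normal_distribution. complex_of_real (exp (s * x)))"
    by (rule integral_complex_of_real[symmetric])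
  also have "\<dots> = of_real (exp (s\<^sup>2 / 2))"
    using std_normal_complex_mgf(2)[of "of_real s"] by (simp add: exp_of_real[symmetric])
  finally have "(LINT x|std_normal_distribution. exp (s * x)) = exp (s\<^sup>2 / 2)"
    using of_real_eq_iff by blast
  with I' show ?thesis by (subst nn_integral_eq_integral) auto
qed

section \<open>Sample means of independent complex variables\<close>

lemma integral_PiM_pair:
  fixes f g :: "'a \<Rightarrow> complex"
  assumes M: "prob_space M" and I: "finite I" "j \<in> I" "k \<in> I" "j \<noteq> k"
    and f: "integrable M f" and g: "integrable M g"
  shows "integrable (\<Pi>\<^sub>M i\<in>I. M) (\<lambda>x. f (x j) * g (x k))"
    and "(CLINT x|(\<Pi>\<^sub>M i\<in>I. M). f (x j) * g (x k)) = (CLINT x|M. f x) * (CLINT x|M. g x)"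
proof -
  interpret M: prob_space M by fact
  interpret P: product_prob_space "\<lambda>_. M" I ..
  define F where "F = (\<lambda>i. if i = j then f else if i = k then g else (\<lambda>_. 1))"
  have prod: "(\<Prod>i\<in>I. F i (x i)) = f (x j) * g (x k)" for x
  proof -
    have "(\<Prod>i\<in>I. F i (x i)) = (\<Prod>i\<in>{j, k}. F i (x i))"
      using I by (intro prod.mono_neutral_right) (auto simp: F_def)
    then show ?thesis using I by (simp add: F_def)
  qed
  have Fint: "integrable M (F i)" for i using f g by (auto simp: F_def)
  show "integrable (\<Pi>\<^sub>M i\<in>I. M) (\<lambda>x. f (x j) * g (x k))"
    using P.product_integrable_prod[of I F, OF I(1) Fint] by (simp add: prod)
  have "(\<Prod>i\<in>I. CLINT x|M. F i x) = (\<Prod>i\<in>{j, k}. CLINT x|M. F i x)"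
    using I by (intro prod.mono_neutral_right) (auto simp: F_def M.prob_space)
  also have "\<dots> = (CLINT x|M. f x) * (CLINT x|M. g x)" using I by (simp add: F_def)
  finally have prodI: "(\<Prod>i\<in>I. CLINT x|M. F i x) = (CLINT x|M. f x) * (CLINT x|M. g x)" .
  show "(CLINT x|(\<Pi>\<^sub>M i\<in>I. M). f (x j) * g (x k)) = (CLINT x|M. f x) * (CLINT x|M. g x)"
    unfolding P.product_integral_prod[of I F, OF I(1) Fint, unfolded prod] by (rule prodI)
qed

text \<open>Chebyshev's inequality for a complex sample mean. The second moment of \<open>Y\<close> bounds its variance, and
the off-diagonal terms in the expansion of \<open>\<bar>\<Sum>(Y\<^sub>j - E Y)\<bar>\<^sup>2\<close> vanish by independence.\<close>

lemma chebyshev_sample_mean: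
  fixes Y :: "'a \<Rightarrow> complex"
  assumes M: "prob_space M" and [measurable]: "Y \<in> borel_measurable M"
    and V: "(\<integral>\<^sup>+x. ennreal ((cmod (Y x))\<^sup>2) \<partial>M) \<le> ennreal V"
    and n: "0 < n" and a: "0 < a" and V0: "0 \<le> V"
  defines "P \<equiv> (\<Pi>\<^sub>M j\<in>{1..n}. M)"
  shows "emeasure P {x \<in> space P. a \<le> cmod ((\<Sum>j=1..n. Y (x j)) / of_nat n - (CLINT x|M. Y x))}
           \<le> ennreal (V / (real n * a\<^sup>2))"
proof -
  interpret M: prob_space M by fact
  interpret P: product_prob_space "\<lambda>_. M" "{1..n}" ..
  let ?I = "{1..n}"
  have PP: "P = PiM ?I (\<lambda>_. M)" by (simp add: P_def)
  have Y2: "integrable M (\<lambda>x. (cmod (Y x))\<^sup>2)"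
    using V by (intro integrableI_bounded) (auto intro: le_less_trans)
  then have Y2': "integrable M (\<lambda>x. Y x ^ 2)"
    by (rule Bochner_Integration.integrable_bound) (auto simp: norm_power)
  have Y1: "integrable M Y"
    by (rule M.square_integrable_imp_integrable[OF _ Y2']) simp
  define m where "m = (CLINT x|M. Y x)"
  define Z where "Z = (\<lambda>x. Y x - m)"
  have [measurable]: "Z \<in> borel_measurable M" by (simp add: Z_def)
  have Z1: "integrable M Z" and Z0: "(CLINT x|M. Z x) = 0"
    using Y1 by (auto simp: Z_def m_def M.prob_space)
  have cZ1: "integrable M (\<lambda>x. cnj (Z x))" using Z1 by simp
  have expand: "of_real ((cmod (Z x))\<^sup>2) = of_real ((cmod (Y x))\<^sup>2) - cnj m * Y x - m * cnj (Y x) + m * cnj m" for x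
    by (simp add: Z_def complex_norm_square algebra_simps of_real_power[symmetric] del: of_real_power)
  have cY1: "integrable M (\<lambda>x. cnj (Y x))" using Y1 by simp
  have ZZc: "integrable M (\<lambda>x. complex_of_real ((cmod (Z x))\<^sup>2))"
    unfolding expand using Y1 cY1 complex_of_real_integrable_eq[THEN iffD2, OF Y2]
    by (intro Bochner_Integration.integrable_add Bochner_Integration.integrable_diff integrable_mult_right)
       (auto simp del: of_real_power)
  then have ZZ: "integrable M (\<lambda>x. (cmod (Z x))\<^sup>2)" unfolding complex_of_real_integrable_eq .
  have "complex_of_real (LINT x|M. (cmod (Z x))\<^sup>2) = (CLINT x|M. complex_of_real ((cmod (Z x))\<^sup>2))"
    by (rule integral_complex_of_real[symmetric])
  also have "\<dots> = (CLINT x|M. complex_of_real ((cmod (Y x))\<^sup>2)) - cnj m * m - m * cnj m + m * cnj m"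
    unfolding expand using Y1 cY1 complex_of_real_integrable_eq[THEN iffD2, OF Y2]
    by (simp add: M.prob_space m_def del: of_real_power)
  also have "\<dots> = of_real ((LINT x|M. (cmod (Y x))\<^sup>2) - (cmod m)\<^sup>2)"
    by (simp only: integral_complex_of_real of_real_diff complex_norm_square[of m]) simp
  finally have "(LINT x|M. (cmod (Z x))\<^sup>2) = (LINT x|M. (cmod (Y x))\<^sup>2) - (cmod m)\<^sup>2"
    using of_real_eq_iff by blast
  moreover have "(LINT x|M. (cmod (Y x))\<^sup>2) \<le> V"
    using V V0 by (subst (asm) nn_integral_eq_integral[OF Y2]) auto
  ultimately have ZV: "(LINT x|M. (cmod (Z x))\<^sup>2) \<le> V" by (smt (verit) zero_le_power2)
  have coord: "integrable P (\<lambda>x. h (x j)) \<and> (CLINT x|P. h (x j)) = (CLINT x|M. h x)" if "j \<in> ?I" "integrable M h" for j and h :: "'a \<Rightarrow> complex"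
  proof -
    have d: "distr P M (\<lambda>x. x j) = M" unfolding PP by (rule P.PiM_component[OF that(1)])
    have m: "(\<lambda>x. x j) \<in> measurable P M" unfolding PP using that by measurable
    have hm: "h \<in> borel_measurable M" using that(2) by auto
    show ?thesis
      using integrable_distr_eq[OF m hm] integral_distr[OF m hm] that(2) unfolding d by simp
  qed
  have pair: "integrable P (\<lambda>x. Z (x j) * cnj (Z (x k))) \<and>
      (CLINT x|P. Z (x j) * cnj (Z (x k))) = (if j = k then of_real (LINT x|M. (cmod (Z x))\<^sup>2) else 0)"
    if jk: "j \<in> ?I" "k \<in> ?I" for j k
  proof (cases "j = k")
    case True
    have "Z (x j) * cnj (Z (x k)) = complex_of_real ((cmod (Z (x j)))\<^sup>2)" for x
      by (simp add: True complex_norm_square of_real_power[symmetric] del: of_real_power)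
    then show ?thesis using coord[OF jk(1) ZZc] True by (simp only: integral_complex_of_real simp_thms if_True)
  next
    case False
    show ?thesis
      using integral_PiM_pair[OF M _ jk False Z1 cZ1] False Z0 by (simp add: PP)
  qed
  define S where "S = (\<lambda>x. \<Sum>j\<in>?I. Z (x j))"
  have Sq: "complex_of_real ((cmod (S x))\<^sup>2) = (\<Sum>j\<in>?I. \<Sum>k\<in>?I. Z (x j) * cnj (Z (x k)))" for x
    unfolding complex_norm_square S_def cnj_sum sum_product ..
  have Sint: "integrable P (\<lambda>x. complex_of_real ((cmod (S x))\<^sup>2))"
    unfolding Sq using pair by (intro Bochner_Integration.integrable_sum) auto
  then have Sint': "integrable P (\<lambda>x. (cmod (S x))\<^sup>2)" unfolding complex_of_real_integrable_eq .
  have "complex_of_real (LINT x|P. (cmod (S x))\<^sup>2) = (CLINT x|P. complex_of_real ((cmod (S x))\<^sup>2))"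
    by (rule integral_complex_of_real[symmetric])
  also have "\<dots> = (\<Sum>j\<in>?I. \<Sum>k\<in>?I. CLINT x|P. Z (x j) * cnj (Z (x k)))"
    unfolding Sq using pair
    by (subst Bochner_Integration.integral_sum, force)
       (intro sum.cong refl Bochner_Integration.integral_sum, blast)
  also have "\<dots> = (\<Sum>j\<in>?I. \<Sum>k\<in>?I. if j = k then of_real (LINT x|M. (cmod (Z x))\<^sup>2) else 0)"
    by (intro sum.cong refl) (use pair in blast)
  also have "\<dots> = of_real (real n * (LINT x|M. (cmod (Z x))\<^sup>2))"
    by (simp add: sum.delta)
  finally have SE: "(LINT x|P. (cmod (S x))\<^sup>2) = real n * (LINT x|M. (cmod (Z x))\<^sup>2)"
    using of_real_eq_iff by blast
  have [measurable]: "S \<in> borel_measurable P" unfolding S_def PP by measurable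
  have "{x \<in> space P. a \<le> cmod ((\<Sum>j=1..n. Y (x j)) / of_nat n - m)}
     = {x \<in> space P. (cmod (S x))\<^sup>2 \<ge> (a * real n)\<^sup>2}"
  proof (intro Collect_cong conj_cong refl)
    fix x
    have "(\<Sum>j=1..n. Y (x j)) / of_nat n - m = S x / of_nat n"
      using n by (simp add: S_def Z_def sum_subtractf field_simps)
    then have "a \<le> cmod ((\<Sum>j=1..n. Y (x j)) / of_nat n - m) \<longleftrightarrow> a * real n \<le> cmod (S x)"
      using n by (simp add: norm_divide le_divide_eq)
    also have "\<dots> \<longleftrightarrow> (cmod (S x))\<^sup>2 \<ge> (a * real n)\<^sup>2"
      using a n by (subst power2_le_iff_abs_le) auto
    finally show "a \<le> cmod ((\<Sum>j=1..n. Y (x j)) / of_nat n - m) \<longleftrightarrow> (cmod (S x))\<^sup>2 \<ge> (a * real n)\<^sup>2" .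
  qed
  also have "emeasure P \<dots> \<le> ennreal (1 / (a * real n)\<^sup>2 * (LINT x|P. (cmod (S x))\<^sup>2))"
    by (rule integral_Markov_inequality[OF Sint']) (use a n in auto)
  also have "\<dots> \<le> ennreal (V / (real n * a\<^sup>2))"
  proof (rule ennreal_leI)
    have "1 / (a * real n)\<^sup>2 * (LINT x|P. (cmod (S x))\<^sup>2) \<le> 1 / (a * real n)\<^sup>2 * (real n * V)"
      unfolding SE using ZV by (intro mult_left_mono) auto
    also have "\<dots> = V / (real n * a\<^sup>2)" using n a by (simp add: field_simps power2_eq_square)
    finally show "1 / (a * real n)\<^sup>2 * (LINT x|P. (cmod (S x))\<^sup>2) \<le> V / (real n * a\<^sup>2)" .
  qed
  finally show ?thesis by (simp add: m_def)
qed

section \<open>The sampling distribution as a Gaussian mixture\<close>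

text \<open>The mixture \<open>(1 - \<epsilon>) \<delta>(p0) + \<epsilon> H\<close>, realised by tossing a coin that decides between \<open>p0\<close> and a
draw from \<open>H\<close>. Treating the null component as one more atom of the mixing law turns the sampling
density into a plain Gaussian mixture.\<close>

definition contaminated_mixing :: "real \<Rightarrow> 'a \<Rightarrow> 'a measure \<Rightarrow> 'a measure" where
  "contaminated_mixing \<epsilon> p0 H =
     distr (measure_pmf (bernoulli_pmf \<epsilon>) \<Otimes>\<^sub>M H) H (\<lambda>(b, p). if b then p else p0)"

lemma contaminated_mixing:
  assumes H: "prob_space H" and p0: "p0 \<in> space H" and \<epsilon>: "0 \<le> \<epsilon>" "\<epsilon> \<le> 1"
  shows prob_space_contaminated_mixing: "prob_space (contaminated_mixing \<epsilon> p0 H)"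
    and sets_contaminated_mixing: "sets (contaminated_mixing \<epsilon> p0 H) = sets H"
    and nn_integral_contaminated_mixing: "f \<in> borel_measurable H \<Longrightarrow>
      (\<integral>\<^sup>+p. f p \<partial>contaminated_mixing \<epsilon> p0 H) = ennreal (1 - \<epsilon>) * f p0 + ennreal \<epsilon> * (\<integral>\<^sup>+p. f p \<partial>H)"
    and integral_contaminated_mixing: "integrable H g \<Longrightarrow>
      (CLINT p|contaminated_mixing \<epsilon> p0 H. g p) = of_real (1 - \<epsilon>) * g p0 + of_real \<epsilon> * (CLINT p|H. g p)"
proof -
  interpret H: prob_space H by fact
  let ?B = "measure_pmf (bernoulli_pmf \<epsilon>)"
  interpret BH: pair_prob_space ?B H ..
  have m[measurable]: "(\<lambda>(b, p). if b then p else p0) \<in> measurable (?B \<Otimes>\<^sub>M H) H"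
    using p0 by measurable
  show "prob_space (contaminated_mixing \<epsilon> p0 H)"
    unfolding contaminated_mixing_def by (rule BH.prob_space_distr[OF m])
  show "sets (contaminated_mixing \<epsilon> p0 H) = sets H"
    by (simp add: contaminated_mixing_def)
  show "(\<integral>\<^sup>+p. f p \<partial>contaminated_mixing \<epsilon> p0 H) = ennreal (1 - \<epsilon>) * f p0 + ennreal \<epsilon> * (\<integral>\<^sup>+p. f p \<partial>H)"
    if [measurable]: "f \<in> borel_measurable H" for f
  proof -
    have "(\<integral>\<^sup>+p. f p \<partial>contaminated_mixing \<epsilon> p0 H) = (\<integral>\<^sup>+q. f (case q of (b, p) \<Rightarrow> if b then p else p0) \<partial>(?B \<Otimes>\<^sub>M H))"
      unfolding contaminated_mixing_def by (subst nn_integral_distr[OF m]) auto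
    also have "\<dots> = (\<integral>\<^sup>+b. \<integral>\<^sup>+p. f (if b then p else p0) \<partial>H \<partial>?B)"
      by (subst H.nn_integral_fst[symmetric]) auto
    also have "\<dots> = ennreal (1 - \<epsilon>) * f p0 + ennreal \<epsilon> * (\<integral>\<^sup>+p. f p \<partial>H)"
      using \<epsilon> by (subst nn_integral_bernoulli_pmf) (auto simp: H.emeasure_space_1 ac_simps)
    finally show ?thesis .
  qed
  show "(CLINT p|contaminated_mixing \<epsilon> p0 H. g p) = of_real (1 - \<epsilon>) * g p0 + of_real \<epsilon> * (CLINT p|H. g p)"
    if g: "integrable H g"
  proof -
    have [measurable]: "g \<in> borel_measurable H" using g by auto
    let ?g = "\<lambda>q. g (case q of (b, p) \<Rightarrow> if b then p else p0)"
    have int: "integrable (?B \<Otimes>\<^sub>M H) ?g"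
    proof (rule BH.Fubini_integrable)
      show "integrable ?B (\<lambda>b. LINT p|H. norm (?g (b, p)))"
        by (rule integrable_measure_pmf_finite) simp
      have "integrable H (\<lambda>p. ?g (b, p))" for b using g by (cases b) auto
      then show "AE b in ?B. integrable H (\<lambda>p. ?g (b, p))" by blast
    qed simp
    have "(CLINT p|contaminated_mixing \<epsilon> p0 H. g p) = (CLINT q|?B \<Otimes>\<^sub>M H. ?g q)"
      unfolding contaminated_mixing_def by (subst integral_distr[OF m]) auto
    also have "\<dots> = (CLINT b|?B. CLINT p|H. ?g (b, p))"
      by (rule BH.integral_fst'[OF int, symmetric])
    also have "\<dots> = of_real (1 - \<epsilon>) * g p0 + of_real \<epsilon> * (CLINT p|H. g p)"
      using \<epsilon> by (subst integral_measure_pmf[of UNIV]) (auto simp: UNIV_bool H.prob_space scaleR_conv_of_real)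
    finally show ?thesis .
  qed
qed

text \<open>The law of \<open>u + \<sigma> Z\<close> with \<open>(u, \<sigma>)\<close> drawn from \<open>H\<close> and \<open>Z\<close> an independent standard normal
variable. Integrals against it reduce, by Fubini, to standard normal integrals.\<close>

definition gaussian_mixture :: "(real \<times> real) measure \<Rightarrow> real measure" where
  "gaussian_mixture H = distr (H \<Otimes>\<^sub>M std_normal_distribution) borel (\<lambda>(p, z). fst p + snd p * z)"

lemma normal_location_scale_measurable:
  assumes "sets H = sets borel"
  shows "(\<lambda>(p, z). fst p + snd p * z) \<in> measurable (H \<Otimes>\<^sub>M std_normal_distribution) (borel :: real measure)"
proof -
  have [measurable_cong]: "sets H = sets (borel \<Otimes>\<^sub>M borel)" by (simp only: assms borel_prod)
  show ?thesis by measurable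
qed

lemma prob_space_gaussian_mixture:
  assumes "prob_space H" "sets H = sets borel"
  shows "prob_space (gaussian_mixture H)"
proof -
  interpret H: prob_space H by fact
  interpret N: prob_space std_normal_distribution by (rule prob_space_normal_density) simp
  interpret HN: pair_prob_space H std_normal_distribution ..
  show ?thesis unfolding gaussian_mixture_def
    by (rule HN.prob_space_distr[OF normal_location_scale_measurable[OF assms(2)]])
qed

lemma sets_gaussian_mixture [simp]: "sets (gaussian_mixture H) = sets borel"
  by (simp add: gaussian_mixture_def)

lemma nn_integral_gaussian_mixture:
  assumes "sets H = sets borel" and f[measurable]: "f \<in> borel_measurable borel"
  shows "(\<integral>\<^sup>+x. f x \<partial>gaussian_mixture H) = (\<integral>\<^sup>+p. \<integral>\<^sup>+z. f (fst p + snd p * z) \<partial>std_normal_distribution \<partial>H)"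
proof -
  interpret N: prob_space std_normal_distribution by (rule prob_space_normal_density) simp
  note [measurable] = normal_location_scale_measurable[OF assms(1)]
  show ?thesis unfolding gaussian_mixture_def
    by (subst nn_integral_distr; simp?) (subst N.nn_integral_fst[symmetric]; simp add: split_beta')
qed

lemma integral_gaussian_mixture:
  fixes f :: "real \<Rightarrow> complex"
  assumes H: "prob_space H" "sets H = sets borel" and f: "integrable (gaussian_mixture H) f"
  shows "(CLINT x|gaussian_mixture H. f x) = (CLINT p|H. CLINT z|std_normal_distribution. f (fst p + snd p * z))"
proof -
  interpret H: prob_space H by fact
  interpret N: prob_space std_normal_distribution by (rule prob_space_normal_density) simp
  interpret HN: pair_prob_space H std_normal_distribution ..
  note m = normal_location_scale_measurable[OF H(2)]
  have fm: "f \<in> borel_measurable borel" using borel_measurable_integrable[OF f] by (simp add: gaussian_mixture_def)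
  have int: "integrable (H \<Otimes>\<^sub>M std_normal_distribution) (\<lambda>q. f (case q of (p, z) \<Rightarrow> fst p + snd p * z))"
    using f integrable_distr_eq[OF m fm] by (simp add: gaussian_mixture_def)
  show ?thesis
    using HN.integral_fst'[OF int] integral_distr[OF m fm] by (simp add: gaussian_mixture_def)
qed

lemma nn_integral_normal_density:
  assumes \<sigma>: "0 < \<sigma>" and [measurable]: "f \<in> borel_measurable borel"
  shows "(\<integral>\<^sup>+x. ennreal (normal_density u \<sigma> x) * f x \<partial>lborel) = (\<integral>\<^sup>+z. f (u + \<sigma> * z) \<partial>std_normal_distribution)"
proof -
  have *: "\<sigma> * normal_density u \<sigma> (u + \<sigma> * z) = std_normal_density z" for z
    using \<sigma> by (simp add: normal_density_def real_sqrt_mult power_mult_distrib)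
  have "(\<integral>\<^sup>+x. ennreal (normal_density u \<sigma> x) * f x \<partial>lborel)
      = ennreal \<sigma> * (\<integral>\<^sup>+z. ennreal (normal_density u \<sigma> (u + \<sigma> * z)) * f (u + \<sigma> * z) \<partial>lborel)"
    using \<sigma> by (subst nn_integral_real_affine[of _ \<sigma> u]) auto
  also have "\<dots> = (\<integral>\<^sup>+z. ennreal (std_normal_density z) * f (u + \<sigma> * z) \<partial>lborel)"
    using \<sigma> by (subst nn_integral_cmult[symmetric]) (auto simp: *[symmetric] ennreal_mult mult.assoc)
  also have "\<dots> = (\<integral>\<^sup>+z. f (u + \<sigma> * z) \<partial>std_normal_distribution)"
    by (subst nn_integral_density) auto
  finally show ?thesis .
qed

text \<open>Tonelli exchanges the mixing integral with the Lebesgue integral over any Borel set, and each normal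
density is an affine image of the standard one.\<close>

lemma density_mix_density:
  assumes H: "prob_space H" "sets H = sets borel" "AE p in H. 0 < snd p"
    and \<epsilon>: "0 \<le> \<epsilon>" "\<epsilon> \<le> 1" and \<sigma>0: "0 < \<sigma>0"
  shows "density lborel (mix_density u0 \<sigma>0 \<epsilon> H) = gaussian_mixture (contaminated_mixing \<epsilon> (u0, \<sigma>0) H)"
proof (rule measure_eqI)
  interpret H: prob_space H by fact
  interpret LH: pair_sigma_finite lborel H ..
  interpret N: prob_space std_normal_distribution by (rule prob_space_normal_density) simp
  have sH[measurable_cong]: "sets H = sets (borel \<Otimes>\<^sub>M borel)" by (simp only: H(2) borel_prod)
  have p0: "(u0, \<sigma>0) \<in> space H" using sets_eq_imp_space_eq[OF H(2)] by simp
  note cm = contaminated_mixing[OF H(1) p0 \<epsilon>]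
  have nd[measurable]: "(\<lambda>q. ennreal (normal_density (fst (snd q)) (snd (snd q)) (fst q))) \<in> borel_measurable (lborel \<Otimes>\<^sub>M H)"
    unfolding normal_density_def by measurable
  have nd2[measurable]: "(\<lambda>p. ennreal (normal_density (fst p) (snd p) x)) \<in> borel_measurable H" for x
    unfolding normal_density_def by measurable
  have nd'[measurable]: "(\<lambda>x. \<integral>\<^sup>+p. ennreal (normal_density (fst p) (snd p) x) \<partial>H) \<in> borel_measurable lborel"
    using H.borel_measurable_nn_integral_fst[OF nd] by simp
  have md[measurable]: "mix_density u0 \<sigma>0 \<epsilon> H \<in> borel_measurable lborel"
    unfolding mix_density_def by measurable
  show "sets (density lborel (mix_density u0 \<sigma>0 \<epsilon> H)) = sets (gaussian_mixture (contaminated_mixing \<epsilon> (u0, \<sigma>0) H))"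
    by simp
  fix B assume "B \<in> sets (density lborel (mix_density u0 \<sigma>0 \<epsilon> H))"
  then have B[measurable]: "B \<in> sets borel" by simp
  let ?G = "\<lambda>p. \<integral>\<^sup>+z. indicator B (fst p + snd p * z) \<partial>std_normal_distribution"
  have G: "(\<integral>\<^sup>+x. ennreal (normal_density u \<sigma> x) * indicator B x \<partial>lborel) = ?G (u, \<sigma>)" if "0 < \<sigma>" for u \<sigma>
    using nn_integral_normal_density[OF that, of "indicator B" u] by simp
  have Gm: "?G \<in> borel_measurable H"
    by (intro N.borel_measurable_nn_integral) measurable
  have "emeasure (density lborel (mix_density u0 \<sigma>0 \<epsilon> H)) B = (\<integral>\<^sup>+x. mix_density u0 \<sigma>0 \<epsilon> H x * indicator B x \<partial>lborel)"
    by (subst emeasure_density) auto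
  also have "\<dots> = (\<integral>\<^sup>+x. ennreal (1 - \<epsilon>) * (ennreal (normal_density u0 \<sigma>0 x) * indicator B x)
      + ennreal \<epsilon> * (\<integral>\<^sup>+p. ennreal (normal_density (fst p) (snd p) x) * indicator B x \<partial>H) \<partial>lborel)"
    using \<epsilon> by (intro nn_integral_cong) (simp add: mix_density_def ennreal_mult nn_integral_multc[OF nd2] distrib_right mult.assoc)
  also have "\<dots> = ennreal (1 - \<epsilon>) * (\<integral>\<^sup>+x. ennreal (normal_density u0 \<sigma>0 x) * indicator B x \<partial>lborel)
      + ennreal \<epsilon> * (\<integral>\<^sup>+x. \<integral>\<^sup>+p. ennreal (normal_density (fst p) (snd p) x) * indicator B x \<partial>H \<partial>lborel)"
    by (simp add: nn_integral_add nn_integral_cmult nn_integral_multc)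
  also have "(\<integral>\<^sup>+x. \<integral>\<^sup>+p. ennreal (normal_density (fst p) (snd p) x) * indicator B x \<partial>H \<partial>lborel)
      = (\<integral>\<^sup>+p. \<integral>\<^sup>+x. ennreal (normal_density (fst p) (snd p) x) * indicator B x \<partial>lborel \<partial>H)"
    by (rule LH.Fubini'[symmetric]) (simp add: split_beta')
  also have "\<dots> = (\<integral>\<^sup>+p. ?G p \<partial>H)"
    using H(3) by (intro nn_integral_cong_AE) (auto elim!: eventually_mono simp: G)
  also have "(\<integral>\<^sup>+x. ennreal (normal_density u0 \<sigma>0 x) * indicator B x \<partial>lborel) = ?G (u0, \<sigma>0)"
    by (rule G[OF \<sigma>0])
  also have "ennreal (1 - \<epsilon>) * ?G (u0, \<sigma>0) + ennreal \<epsilon> * (\<integral>\<^sup>+p. ?G p \<partial>H)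
      = (\<integral>\<^sup>+p. ?G p \<partial>contaminated_mixing \<epsilon> (u0, \<sigma>0) H)"
    by (rule cm(3)[OF Gm, symmetric])
  also have "\<dots> = (\<integral>\<^sup>+x. indicator B x \<partial>gaussian_mixture (contaminated_mixing \<epsilon> (u0, \<sigma>0) H))"
    by (rule nn_integral_gaussian_mixture[symmetric]) (use cm(2) H(2) in auto)
  also have "\<dots> = emeasure (gaussian_mixture (contaminated_mixing \<epsilon> (u0, \<sigma>0) H)) B" by simp
  finally show "emeasure (density lborel (mix_density u0 \<sigma>0 \<epsilon> H)) B
      = emeasure (gaussian_mixture (contaminated_mixing \<epsilon> (u0, \<sigma>0) H)) B" .
qed

section \<open>The estimators as functionals of the normalized transform\<close>

text \<open>The number \<open>\<omega>\<close> is an eighth root of unity with \<open>\<omega>\<^sup>2 = i\<close>. Hence a normal variable has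
\<open>E exp(\<omega>tX) = exp(\<omega>tu + it\<^sup>2\<sigma>\<^sup>2/2)\<close>: the variance only rotates the phase, while the mean
scales the modulus by \<open>exp(-tu/\<surd>2)\<close>.\<close>

lemma Re_omega: "Re omega = - 1 / sqrt 2" and Im_omega: "Im omega = - 1 / sqrt 2"
  by (simp_all add: omega_def Re_divide_of_real Im_divide_of_real)

lemma omega_mult_self: "omega * omega = \<i>"
  by (simp add: complex_eq_iff Re_omega Im_omega)

lemma norm_omega [simp]: "cmod omega = 1"
  by (simp add: cmod_def Re_omega Im_omega power_divide)

text \<open>The summand \<open>exp(\<omega>tx)\<close> divided by its mean under the null component \<open>N(u0, \<sigma>0\<^sup>2)\<close>.\<close>

definition kern :: "real \<Rightarrow> real \<Rightarrow> real \<Rightarrow> real \<Rightarrow> complex" where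
  "kern u0 \<sigma>0 t x = exp (omega * of_real (t * (x - u0)) - \<i> * of_real (t\<^sup>2 * \<sigma>0\<^sup>2 / 2))"

definition kern_deriv :: "real \<Rightarrow> real \<Rightarrow> real \<Rightarrow> real \<Rightarrow> complex" where
  "kern_deriv u0 \<sigma>0 t x = (omega * of_real (x - u0) - \<i> * of_real (t * \<sigma>0\<^sup>2)) * kern u0 \<sigma>0 t x"

lemma kern_has_vector_derivative:
  "((\<lambda>t. kern u0 \<sigma>0 t x) has_vector_derivative kern_deriv u0 \<sigma>0 t x) (at t)"
  unfolding kern_def kern_deriv_def
  by (auto intro!: derivative_eq_intros has_vector_derivative_real_field simp: algebra_simps)

lemma norm_kern: "cmod (kern u0 \<sigma>0 t x) = exp (- (t * (x - u0)) / sqrt 2)"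
  by (simp add: kern_def Re_omega)

text \<open>The generalized characteristic function of \<open>N(u0, \<sigma>0\<^sup>2)\<close>, evaluated at \<open>t\<close>.\<close>

definition ref_cf :: "real \<Rightarrow> real \<Rightarrow> real \<Rightarrow> complex" where
  "ref_cf u0 \<sigma>0 t = exp (omega * of_real (t * u0) + \<i> * of_real (t\<^sup>2 * \<sigma>0\<^sup>2 / 2))"

lemma ref_cf_nonzero [simp]: "ref_cf u0 \<sigma>0 t \<noteq> 0" by (simp add: ref_cf_def)

lemma ref_cf_has_vector_derivative:
  "((ref_cf u0 \<sigma>0) has_vector_derivative (omega * of_real u0 + \<i> * of_real (t * \<sigma>0\<^sup>2)) * ref_cf u0 \<sigma>0 t) (at t)"
  unfolding ref_cf_def
  by (auto intro!: derivative_eq_intros has_vector_derivative_real_field simp: algebra_simps)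

lemma gen_ecf_factor:
  "gen_ecf n x t = ref_cf u0 \<sigma>0 t * ((\<Sum>j=1..n. kern u0 \<sigma>0 t (x j)) / of_nat n)"
proof -
  have "exp (omega * of_real t * of_real y) = ref_cf u0 \<sigma>0 t * kern u0 \<sigma>0 t y" for y
    unfolding ref_cf_def kern_def exp_add[symmetric] by (rule arg_cong[where f=exp]) (simp add: algebra_simps)
  then show ?thesis by (simp add: gen_ecf_def sum_distrib_left)
qed

lemma has_field_derivative_cmod:
  fixes g :: "real \<Rightarrow> complex"
  assumes "(g has_vector_derivative w * g t) (at t)" "g t \<noteq> 0"
  shows "((\<lambda>s. cmod (g s)) has_field_derivative cmod (g t) * Re w) (at t)"
proof -
  have "((\<lambda>s. cmod (g s)) has_derivative (\<lambda>h. inner (sgn (g t)) (h *\<^sub>R (w * g t)))) (at t)"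
    using has_derivative_compose[OF assms(1)[unfolded has_vector_derivative_def] has_derivative_norm[OF assms(2)]]
    by (simp add: inner_commute)
  moreover have "inner (sgn (g t)) (w * g t) = cmod (g t) * Re w"
  proof -
    have "inner (sgn (g t)) (w * g t) = Re w * ((Re (g t))\<^sup>2 + (Im (g t))\<^sup>2) / cmod (g t)"
      using assms(2) by (simp add: inner_complex_def sgn_eq field_simps power2_eq_square)
    also have "\<dots> = Re w * (cmod (g t))\<^sup>2 / cmod (g t)" by (simp add: cmod_power2)
    finally show ?thesis using assms(2) by (simp add: power2_eq_square)
  qed
  ultimately show ?thesis
    by (simp add: has_field_derivative_def mult.commute mult_commute_abs)
qed

text \<open>Both functionals read off the logarithmic derivative \<open>g'/g\<close>, which is \<open>\<omega>u0 + it\<sigma>0\<^sup>2 + G'/G\<close>.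
On the first two terms they return exactly \<open>u0\<close> and \<open>\<sigma>0\<^sup>2\<close>: the variance term is purely
imaginary, and multiplication by \<open>\<omega>\<close> makes the location term imaginary instead. The estimation
errors are therefore linear in \<open>G'/G\<close>.\<close>

lemma estimator_functionals:
  assumes g: "\<And>s. g s = ref_cf u0 \<sigma>0 s * G s" and G: "(G has_vector_derivative G1) (at t)"
    and nz: "G t \<noteq> 0" and t: "0 < t"
  shows "u0_fun g t = u0 - sqrt 2 * Re (G1 / G t)"
    and "sigma0sq_fun g t = \<sigma>0\<^sup>2 + sqrt 2 / t * Re (omega * (G1 / G t))"
proof -
  define q where "q = G1 / G t"
  define w where "w = omega * of_real u0 + \<i> * of_real (t * \<sigma>0\<^sup>2) + q"
  have gnz: "g t \<noteq> 0" using nz by (simp add: g)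
  have g': "(g has_vector_derivative w * g t) (at t)"
  proof -
    have "((\<lambda>s. ref_cf u0 \<sigma>0 s * G s) has_vector_derivative
        (ref_cf u0 \<sigma>0 t * G1 + (omega * of_real u0 + \<i> * of_real (t * \<sigma>0\<^sup>2)) * ref_cf u0 \<sigma>0 t * G t)) (at t)"
      by (rule has_vector_derivative_mult[OF ref_cf_has_vector_derivative G])
    moreover have "ref_cf u0 \<sigma>0 t * G1 + (omega * of_real u0 + \<i> * of_real (t * \<sigma>0\<^sup>2)) * ref_cf u0 \<sigma>0 t * G t = w * g t"
      using nz by (simp add: w_def q_def g algebra_simps)
    moreover have "g = (\<lambda>s. ref_cf u0 \<sigma>0 s * G s)" using g by auto
    ultimately show ?thesis by simp
  qed
  have "u0_fun g t = - (sqrt 2) * Re w"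
    unfolding u0_fun_def DERIV_imp_deriv[OF has_field_derivative_cmod[OF g' gnz]] using gnz by simp
  also have "\<dots> = u0 - sqrt 2 * Re q"
    by (simp add: w_def Re_omega algebra_simps)
  finally show "u0_fun g t = u0 - sqrt 2 * Re (G1 / G t)" by (simp add: q_def)
  have "omega * cnj (g t) * (w * g t) = of_real ((cmod (g t))\<^sup>2) * (omega * w)"
    by (simp only: complex_norm_square) (simp add: algebra_simps)
  then have "sigma0sq_fun g t = sqrt 2 * Re (omega * w) / t"
    unfolding sigma0sq_fun_def vector_derivative_at[OF g'] using gnz t
    by (simp only: Re_complex_of_real Im_complex_of_real times_complex.sel) (simp add: field_simps)
  also have "\<dots> = \<sigma>0\<^sup>2 + sqrt 2 / t * Re (omega * q)"
  proof -
    have "omega * w = \<i> * of_real u0 + omega * \<i> * of_real (t * \<sigma>0\<^sup>2) + omega * q"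
      using omega_mult_self by (simp add: w_def algebra_simps)
    then have "Re (omega * w) = t * \<sigma>0\<^sup>2 / sqrt 2 + Re (omega * q)" by (simp add: Im_omega)
    then show ?thesis using t by (simp add: field_simps)
  qed
  finally show "sigma0sq_fun g t = \<sigma>0\<^sup>2 + sqrt 2 / t * Re (omega * (G1 / G t))" by (simp add: q_def)
qed

text \<open>The true parameters would cancel \<open>ref_cf\<close> exactly. The estimated ones leave a factor \<open>exp z\<close>,
where \<open>z\<close> collects the two estimation errors and so is linear in \<open>q = G'/G\<close>.\<close>

lemma eps_fun_at_estimators:
  assumes g: "g t = ref_cf u0 \<sigma>0 t * G" and t: "0 < t"
    and u: "u = u0 - sqrt 2 * Re q" and s: "s = \<sigma>0\<^sup>2 + sqrt 2 / t * Re (omega * q)"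
  obtains z where "eps_fun g t u s = 1 - exp z * G" and "cmod z \<le> 2 * (t * cmod q)"
proof
  define z where "z = of_real t * (of_real (- Re q) - \<i> * of_real ((Re q + Im q) / 2))"
  have sq: "of_real (sqrt 2) * omega = - (1 + \<i>)" by (simp add: omega_def)
  have Roq: "sqrt 2 * Re (omega * q) = Im q - Re q"
    by (simp add: Re_omega Im_omega field_simps)
  have "- omega * of_real u * of_real t - \<i> * of_real s * (of_real t)\<^sup>2 / 2
     + (omega * of_real (t * u0) + \<i> * of_real (t\<^sup>2 * \<sigma>0\<^sup>2 / 2))
     = (of_real (sqrt 2) * omega) * of_real (Re q * t) - \<i> * of_real (sqrt 2 * Re (omega * q)) * of_real t / 2"
    using t by (simp add: u s power2_eq_square field_simps del: times_complex.sel)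
  also have "\<dots> = z" unfolding sq Roq by (simp add: z_def field_simps)
  finally have z: "exp (- omega * of_real u * of_real t - \<i> * of_real s * (of_real t)\<^sup>2 / 2) * ref_cf u0 \<sigma>0 t = exp z"
    unfolding ref_cf_def exp_add[symmetric] by simp
  show "eps_fun g t u s = 1 - exp z * G"
    unfolding eps_fun_def g mult.assoc[symmetric] z ..
  have "cmod (of_real (- Re q) - \<i> * of_real ((Re q + Im q) / 2)) \<le> cmod (of_real (- Re q)) + cmod (\<i> * of_real ((Re q + Im q) / 2))"
    by (rule norm_triangle_ineq4)
  also have "\<dots> = \<bar>Re q\<bar> + \<bar>Re q + Im q\<bar> / 2" by (simp only: norm_mult norm_of_real norm_ii) simp
  also have "\<dots> \<le> cmod q + cmod q"
  proof (rule add_mono[OF abs_Re_le_cmod])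
    show "\<bar>Re q + Im q\<bar> / 2 \<le> cmod q"
      using order_trans[OF abs_triangle_ineq add_mono[OF abs_Re_le_cmod abs_Im_le_cmod], of q q] by simp
  qed
  also have "\<dots> = 2 * cmod q" by simp
  finally have "cmod (of_real (- Re q) - \<i> * of_real ((Re q + Im q) / 2)) \<le> 2 * cmod q" .
  then have "t * cmod (of_real (- Re q) - \<i> * of_real ((Re q + Im q) / 2)) \<le> t * (2 * cmod q)"
    using t by (intro mult_left_mono) auto
  then show "cmod z \<le> 2 * (t * cmod q)" using t by (simp only: z_def norm_mult norm_of_real abs_of_pos)
qed

text \<open>If \<open>G\<close> is within \<open>O(\<theta>\<epsilon>)\<close> of \<open>1 - \<epsilon>\<close> and \<open>tG'\<close> is \<open>O(\<theta>\<epsilon>)\<close>, then \<open>z = O(\<theta>\<epsilon>)\<close> and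
\<open>1 - exp(z) G = \<epsilon> + O(\<theta>\<epsilon>)\<close>. All probability enters through these two conditions.\<close>

lemma eps_estimate_deterministic:
  fixes G G1 :: complex
  assumes g: "\<And>s. g s = ref_cf u0 \<sigma>0 s * Gf s" and G: "(Gf has_vector_derivative G1) (at t)"
    and t: "0 < t" and \<epsilon>: "0 < \<epsilon>" "\<epsilon> < 1/2" and \<theta>: "0 \<le> \<theta>" "\<theta> \<le> 1/16"
    and b0: "cmod (Gf t - of_real (1 - \<epsilon>)) \<le> 2 * \<theta> * \<epsilon>" and b1: "t * cmod G1 \<le> 2 * \<theta> * \<epsilon>"
  shows "g t \<noteq> 0"
    and "cmod (eps_fun g t (u0_fun g t) (sigma0sq_fun g t) / of_real \<epsilon> - 1) \<le> 38 * \<theta>"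
proof -
  have \<theta>\<epsilon>: "\<theta> * \<epsilon> \<le> 1/16 * (1/2)" using \<epsilon> \<theta> by (intro mult_mono) auto
  have "1 - \<epsilon> = cmod (of_real (1 - \<epsilon>))" using \<epsilon> by (simp only: norm_of_real)
  also have "\<dots> \<le> cmod (Gf t) + cmod (Gf t - of_real (1 - \<epsilon>))"
    by (metis norm_triangle_sub norm_minus_commute)
  \<comment> \<open>\<open>G\<close> stays away from zero because \<open>1 - \<epsilon>\<close> exceeds one half.\<close>
  finally have G4: "1/4 \<le> cmod (Gf t)" using b0 \<epsilon> \<theta>\<epsilon> by linarith
  then have nz: "Gf t \<noteq> 0" by auto
  then show "g t \<noteq> 0" by (simp add: g)
  define q where "q = G1 / Gf t"
  have "t * cmod q = t * cmod G1 / cmod (Gf t)" by (simp add: q_def norm_divide)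
  also have "\<dots> \<le> 2 * \<theta> * \<epsilon> / (1/4)"
    using b1 G4 \<epsilon> \<theta> by (intro frac_le) auto
  finally have tq: "t * cmod q \<le> 8 * (\<theta> * \<epsilon>)" by simp
  note est = estimator_functionals[OF g G nz t, folded q_def]
  obtain z where z: "eps_fun g t (u0_fun g t) (sigma0sq_fun g t) = 1 - exp z * Gf t" "cmod z \<le> 2 * (t * cmod q)"
    by (rule eps_fun_at_estimators[where g = g and t = t, OF g t est])
  have z16: "cmod z \<le> 16 * (\<theta> * \<epsilon>)" using z(2) tq by simp
  then have zh: "cmod z \<le> 1/2" using \<theta>\<epsilon> by simp
  have ez: "cmod (exp z) \<le> 2" by (rule exp_bound_half[OF zh])
  have ez1: "cmod (exp z - 1) \<le> 2 * cmod z"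
  proof -
    have "cmod (exp z - 1) \<le> exp \<bar>Re z\<bar> * cmod z"
      using Taylor_exp[of z 0] by simp
    also have "\<dots> \<le> 2 * cmod z"
    proof (rule mult_right_mono)
      have "exp \<bar>Re z\<bar> \<le> exp (1/2)" using abs_Re_le_cmod[of z] zh by simp
      then show "exp \<bar>Re z\<bar> \<le> 2" using exp_half_le2 by linarith
    qed simp
    finally show ?thesis .
  qed
  have "1 - exp z * Gf t - of_real \<epsilon> = - (of_real (1 - \<epsilon>) * (exp z - 1)) - exp z * (Gf t - of_real (1 - \<epsilon>))"
    by (simp add: algebra_simps)
  also have "cmod \<dots> \<le> cmod (of_real (1 - \<epsilon>) * (exp z - 1)) + cmod (exp z * (Gf t - of_real (1 - \<epsilon>)))"
    by (rule order_trans[OF norm_triangle_ineq4]) simp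
  also have "\<dots> \<le> 1 * (2 * (16 * (\<theta> * \<epsilon>))) + 2 * (2 * \<theta> * \<epsilon>)"
    unfolding norm_mult using \<epsilon> ez ez1 z16 b0 by (intro add_mono mult_mono) (auto simp del: of_real_diff)
  also have "\<dots> \<le> 38 * \<theta> * \<epsilon>" using \<theta> \<epsilon> by (simp add: mult_nonneg_nonneg)
  finally have main: "cmod (1 - exp z * Gf t - of_real \<epsilon>) \<le> 38 * \<theta> * \<epsilon>" .
  have "cmod (eps_fun g t (u0_fun g t) (sigma0sq_fun g t) / of_real \<epsilon> - 1) = cmod ((1 - exp z * Gf t - of_real \<epsilon>) / of_real \<epsilon>)"
    using \<epsilon> by (simp add: z(1) diff_divide_distrib)
  also have "\<dots> \<le> 38 * \<theta>" using main \<epsilon> by (simp add: norm_divide divide_le_eq)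
  finally show "cmod (eps_fun g t (u0_fun g t) (sigma0sq_fun g t) / of_real \<epsilon> - 1) \<le> 38 * \<theta>" .
qed

section \<open>Moments of the normalized kernel\<close>

text \<open>The mean of \<open>kern\<close> under the component \<open>N(u, \<sigma>\<^sup>2)\<close>: with \<open>\<delta> = u - u0\<close> and
\<open>\<kappa> = (\<sigma>\<^sup>2 - \<sigma>0\<^sup>2)/2\<close> it equals \<open>exp(\<omega>t\<delta> + it\<^sup>2\<kappa>)\<close>. The constant below is its derivative in
\<open>t\<close>, that is, the mean of \<open>kern_deriv\<close>.\<close>

definition mix_term :: "real \<Rightarrow> real \<Rightarrow> real \<Rightarrow> real \<times> real \<Rightarrow> complex" where
  "mix_term u0 \<sigma>0 t p = exp (omega * of_real (t * (fst p - u0)) + \<i> * of_real (t\<^sup>2 * (((snd p)\<^sup>2 - \<sigma>0\<^sup>2) / 2)))"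

definition mix_term_deriv :: "real \<Rightarrow> real \<Rightarrow> real \<Rightarrow> real \<times> real \<Rightarrow> complex" where
  "mix_term_deriv u0 \<sigma>0 t p =
     (omega * of_real (fst p - u0) + 2 * \<i> * of_real (t * (((snd p)\<^sup>2 - \<sigma>0\<^sup>2) / 2))) * mix_term u0 \<sigma>0 t p"

lemma kern_location_scale:
  "kern u0 \<sigma>0 t (u + \<sigma> * z) = exp (omega * of_real (t * (u - u0)) - \<i> * of_real (t\<^sup>2 * \<sigma>0\<^sup>2 / 2)) * exp (omega * of_real (t * \<sigma>) * of_real z)"
  unfolding kern_def exp_add[symmetric] by (rule arg_cong[where f=exp]) (simp add: algebra_simps)

lemma mix_term_eq:
  "exp (omega * of_real (t * (u - u0)) - \<i> * of_real (t\<^sup>2 * \<sigma>0\<^sup>2 / 2)) * exp ((omega * of_real (t * \<sigma>))\<^sup>2 / 2) = mix_term u0 \<sigma>0 t (u, \<sigma>)"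
proof -
  have "(omega * of_real (t * \<sigma>))\<^sup>2 = \<i> * of_real (t\<^sup>2 * \<sigma>\<^sup>2)"
    using omega_mult_self by (simp add: power2_eq_square mult.assoc mult.left_commute mult.commute)
  then show ?thesis
    unfolding mix_term_def exp_add[symmetric]
    by (intro arg_cong[where f=exp]) (simp add: field_simps)
qed

lemma expectation_kern:
  "(CLINT z|std_normal_distribution. kern u0 \<sigma>0 t (u + \<sigma> * z)) = mix_term u0 \<sigma>0 t (u, \<sigma>)"
  unfolding kern_location_scale
  by (simp only: integral_mult_right_zero std_normal_complex_mgf(2) mix_term_eq)

lemma expectation_kern_deriv:
  "(CLINT z|std_normal_distribution. kern_deriv u0 \<sigma>0 t (u + \<sigma> * z)) = mix_term_deriv u0 \<sigma>0 t (u, \<sigma>)"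
proof -
  define c where "c = omega * of_real (t * \<sigma>)"
  define E where "E = exp (omega * of_real (t * (u - u0)) - \<i> * of_real (t\<^sup>2 * \<sigma>0\<^sup>2 / 2))"
  define a where "a = omega * of_real (u - u0) - \<i> * of_real (t * \<sigma>0\<^sup>2)"
  have eq: "kern_deriv u0 \<sigma>0 t (u + \<sigma> * z) = (a * E) * exp (c * of_real z) + (omega * of_real \<sigma> * E) * (of_real z * exp (c * of_real z))" for z
    unfolding kern_deriv_def kern_location_scale by (simp add: E_def c_def a_def algebra_simps)
  note mg = std_normal_complex_mgf[of c]
  have "(CLINT z|std_normal_distribution. kern_deriv u0 \<sigma>0 t (u + \<sigma> * z))
      = (a * E) * exp (c\<^sup>2 / 2) + (omega * of_real \<sigma> * E) * (c * exp (c\<^sup>2 / 2))"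
    unfolding eq using mg by (simp only: Bochner_Integration.integral_add integrable_mult_right integral_mult_right_zero)
  also have "\<dots> = (a + omega * omega * of_real (t * \<sigma>\<^sup>2)) * (E * exp (c\<^sup>2 / 2))"
    by (simp add: c_def algebra_simps power2_eq_square)
  also have "a + omega * omega * of_real (t * \<sigma>\<^sup>2) = omega * of_real (u - u0) + 2 * \<i> * of_real (t * ((\<sigma>\<^sup>2 - \<sigma>0\<^sup>2) / 2))"
    unfolding omega_mult_self a_def by (simp add: field_simps)
  finally show ?thesis unfolding E_def c_def mix_term_eq by (simp add: mix_term_deriv_def)
qed

lemma kern_measurable [measurable]: "kern u0 \<sigma>0 t \<in> borel_measurable borel"
  and kern_deriv_measurable [measurable]: "kern_deriv u0 \<sigma>0 t \<in> borel_measurable borel"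
  unfolding kern_def[abs_def] kern_deriv_def[abs_def] by measurable

lemma mix_term_measurable:
  assumes "sets H = sets borel"
  shows "mix_term u0 \<sigma>0 t \<in> borel_measurable H" and "mix_term_deriv u0 \<sigma>0 t \<in> borel_measurable H"
proof -
  have [measurable_cong]: "sets H = sets (borel \<Otimes>\<^sub>M borel)" by (simp only: assms borel_prod)
  show "mix_term u0 \<sigma>0 t \<in> borel_measurable H" and "mix_term_deriv u0 \<sigma>0 t \<in> borel_measurable H"
    unfolding mix_term_def[abs_def] mix_term_deriv_def[abs_def] by measurable
qed

lemma norm_mix_term: "cmod (mix_term u0 \<sigma>0 t p) = exp (- (t * (fst p - u0)) / sqrt 2)"
  by (simp add: mix_term_def Re_omega)

text \<open>Large shifts are harmless: a factor \<open>t\<delta>\<close> produced by differentiation is absorbed by the decay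
\<open>exp(-t\<delta>/\<surd>2)\<close>.\<close>

lemma mult_exp_neg_le:
  fixes y :: real
  assumes "0 \<le> y"
  shows "y * exp (- y / sqrt 2) \<le> 2"
proof -
  have "y / sqrt 2 \<le> exp (y / sqrt 2)" using exp_ge_add_one_self[of "y / sqrt 2"] by linarith
  then have "y / sqrt 2 * exp (- y / sqrt 2) \<le> exp (y / sqrt 2) * exp (- y / sqrt 2)" by (intro mult_right_mono) auto
  also have "\<dots> = 1" by (simp add: exp_add[symmetric])
  finally have "y * exp (- y / sqrt 2) \<le> sqrt 2" by (simp add: field_simps)
  also have "sqrt 2 \<le> 2" by (simp add: real_le_lsqrt)
  finally show ?thesis .
qed

lemma norm_mix_term_deriv_le:
  assumes "u0 \<le> fst p"
  shows "cmod (mix_term_deriv u0 \<sigma>0 t p)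
    \<le> ((fst p - u0) + \<bar>t\<bar> * \<bar>(snd p)\<^sup>2 - \<sigma>0\<^sup>2\<bar>) * exp (- (t * (fst p - u0)) / sqrt 2)"
proof -
  have "cmod (omega * of_real (fst p - u0) + 2 * \<i> * of_real (t * (((snd p)\<^sup>2 - \<sigma>0\<^sup>2) / 2)))
     \<le> cmod (omega * of_real (fst p - u0)) + cmod (2 * \<i> * of_real (t * (((snd p)\<^sup>2 - \<sigma>0\<^sup>2) / 2)))"
    by (rule norm_triangle_ineq)
  also have "\<dots> = (fst p - u0) + \<bar>t\<bar> * \<bar>(snd p)\<^sup>2 - \<sigma>0\<^sup>2\<bar>"
    using assms by (simp only: norm_mult norm_of_real norm_omega norm_ii) (simp add: abs_mult)
  finally show ?thesis unfolding mix_term_deriv_def norm_mult norm_mix_term by (intro mult_right_mono) auto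
qed

lemma exponential_moment_normal:
  "(\<integral>\<^sup>+z. ennreal (exp (- s * (u + \<sigma> * z - u0))) \<partial>std_normal_distribution)
     = ennreal (exp (- s * (u - u0) + s\<^sup>2 * \<sigma>\<^sup>2 / 2))"
proof -
  have "exp (- s * (u + \<sigma> * z - u0)) = exp (- s * (u - u0)) * exp ((- s * \<sigma>) * z)" for z
    unfolding exp_add[symmetric] by (simp add: algebra_simps)
  then have "(\<integral>\<^sup>+z. ennreal (exp (- s * (u + \<sigma> * z - u0))) \<partial>std_normal_distribution)
     = ennreal (exp (- s * (u - u0))) * (\<integral>\<^sup>+z. ennreal (exp ((- s * \<sigma>) * z)) \<partial>std_normal_distribution)"
    by (subst nn_integral_cmult[symmetric]) (auto simp: ennreal_mult)
  also have "\<dots> = ennreal (exp (- s * (u - u0) + s\<^sup>2 * \<sigma>\<^sup>2 / 2))"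
    unfolding std_normal_real_mgf by (simp add: ennreal_mult[symmetric] exp_add[symmetric] power_mult_distrib)
  finally show ?thesis .
qed

text \<open>A nonnegative shift only decreases \<open>E exp(-s(X - u0))\<close>. Admitting exponents slightly above
\<open>\<surd>2 t\<close> costs no more than replacing \<open>t\<^sup>2\<close> by \<open>(t + 1)\<^sup>2\<close>.\<close>

lemma exponential_moment_le:
  assumes "u0 \<le> u" "\<sigma>\<^sup>2 \<le> B" "0 \<le> s" "s \<le> sqrt 2 * (t + 1)"
  shows "(\<integral>\<^sup>+z. ennreal (exp (- s * (u + \<sigma> * z - u0))) \<partial>std_normal_distribution) \<le> ennreal (exp ((t + 1)\<^sup>2 * B))"
  unfolding exponential_moment_normal
proof (rule ennreal_leI, subst exp_le_cancel_iff)
  have "s\<^sup>2 \<le> (sqrt 2 * (t + 1))\<^sup>2" using assms by (intro power_mono) auto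
  then have "s\<^sup>2 / 2 \<le> (t + 1)\<^sup>2" by (simp add: power_mult_distrib)
  then have "s\<^sup>2 / 2 * \<sigma>\<^sup>2 \<le> (t + 1)\<^sup>2 * B" using assms by (intro mult_mono) auto
  moreover have "0 \<le> s * (u - u0)" using assms by simp
  ultimately show "- s * (u - u0) + s\<^sup>2 * \<sigma>\<^sup>2 / 2 \<le> (t + 1)\<^sup>2 * B" by simp
qed

text \<open>This bound trades the polynomial factor of the differentiated kernel for exponentials whose exponent
is moved by one. The moments of the derivative then follow from the real moment generating function
alone.\<close>

lemma square_le_exp: "y\<^sup>2 \<le> 2 * (exp y + exp (- y))" for y :: real
proof (cases "0 \<le> y")
  case True
  then have "y\<^sup>2 / 2 \<le> exp y" using exp_lower_Taylor_quadratic[of y] by linarith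
  then have "y\<^sup>2 \<le> 2 * exp y" by simp
  also have "\<dots> \<le> 2 * (exp y + exp (- y))" by simp
  finally show ?thesis .
next
  case False
  then have "y\<^sup>2 / 2 \<le> exp (-y)" using exp_lower_Taylor_quadratic[of "-y"] by simp
  then have "y\<^sup>2 \<le> 2 * exp (- y)" by simp
  also have "\<dots> \<le> 2 * (exp y + exp (- y))" by simp
  finally show ?thesis .
qed

lemma norm_kern_sq: "(cmod (kern u0 \<sigma>0 t x))\<^sup>2 = exp (- (sqrt 2 * t) * (x - u0))"
proof -
  have "2 * (- (t * (x - u0)) / sqrt 2) = - (sqrt 2 * t) * (x - u0)"
    by (simp add: field_simps)
  then show ?thesis by (simp add: norm_kern exp_double[symmetric])
qed

lemma norm_kern_deriv_sq_le:
  "(cmod (kern_deriv u0 \<sigma>0 t x))\<^sup>2 \<le>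
     4 * exp (- (sqrt 2 * t - 1) * (x - u0)) + 4 * exp (- (sqrt 2 * t + 1) * (x - u0))
     + 2 * t\<^sup>2 * \<sigma>0 ^ 4 * exp (- (sqrt 2 * t) * (x - u0))"
proof -
  define y where "y = x - u0"
  have "cmod (omega * of_real y - \<i> * of_real (t * \<sigma>0\<^sup>2)) \<le> cmod (omega * of_real y) + cmod (\<i> * of_real (t * \<sigma>0\<^sup>2))"
    by (rule norm_triangle_ineq4)
  also have "\<dots> = \<bar>y\<bar> + \<bar>t * \<sigma>0\<^sup>2\<bar>" by (simp only: norm_mult norm_of_real norm_omega norm_ii mult_1)
  finally have "(cmod (omega * of_real y - \<i> * of_real (t * \<sigma>0\<^sup>2)))\<^sup>2 \<le> (\<bar>y\<bar> + \<bar>t * \<sigma>0\<^sup>2\<bar>)\<^sup>2"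
    by (intro power_mono) auto
  also have "\<dots> \<le> 2 * y\<^sup>2 + 2 * (t * \<sigma>0\<^sup>2)\<^sup>2"
    using zero_le_power2[of "\<bar>y\<bar> - \<bar>t * \<sigma>0\<^sup>2\<bar>"] by (simp add: power2_sum power2_diff del: zero_le_power2)
  also have "\<dots> \<le> 4 * exp y + 4 * exp (- y) + 2 * t\<^sup>2 * \<sigma>0 ^ 4"
    using square_le_exp[of y] by (simp add: power_mult_distrib)
  finally have "(cmod (omega * of_real y - \<i> * of_real (t * \<sigma>0\<^sup>2)))\<^sup>2 * exp (- (sqrt 2 * t) * y) \<le> (4 * exp y + 4 * exp (- y) + 2 * t\<^sup>2 * \<sigma>0 ^ 4) * exp (- (sqrt 2 * t) * y)"
    by (rule mult_right_mono) simp
  also have "\<dots> = 4 * exp (- (sqrt 2 * t - 1) * y) + 4 * exp (- (sqrt 2 * t + 1) * y) + 2 * t\<^sup>2 * \<sigma>0 ^ 4 * exp (- (sqrt 2 * t) * y)"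
    by (simp add: algebra_simps exp_add[symmetric] exp_diff exp_minus divide_inverse)
  finally show ?thesis
    unfolding kern_deriv_def norm_mult power_mult_distrib norm_kern_sq by (simp only: y_def)
qed

lemma second_moments_normal:
  assumes "u0 \<le> u" "\<sigma>\<^sup>2 \<le> B" "1 \<le> t"
  shows "(\<integral>\<^sup>+z. ennreal ((cmod (kern u0 \<sigma>0 t (u + \<sigma> * z)))\<^sup>2) \<partial>std_normal_distribution)
           \<le> ennreal ((8 + 2 * t\<^sup>2 * \<sigma>0 ^ 4) * exp ((t + 1)\<^sup>2 * B))"
    and "(\<integral>\<^sup>+z. ennreal ((cmod (kern_deriv u0 \<sigma>0 t (u + \<sigma> * z)))\<^sup>2) \<partial>std_normal_distribution)
           \<le> ennreal ((8 + 2 * t\<^sup>2 * \<sigma>0 ^ 4) * exp ((t + 1)\<^sup>2 * B))"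
proof -
  let ?N = std_normal_distribution
  have s2: "1 \<le> sqrt 2" by simp
  have st: "1 \<le> sqrt 2 * t" using mult_mono[OF s2 assms(3)] by simp
  have m0: "(\<integral>\<^sup>+z. ennreal (exp (- (sqrt 2 * t) * (u + \<sigma> * z - u0))) \<partial>?N) \<le> ennreal (exp ((t + 1)\<^sup>2 * B))"
    using assms by (intro exponential_moment_le) (auto simp: algebra_simps)
  have m1: "(\<integral>\<^sup>+z. ennreal (exp (- (sqrt 2 * t - 1) * (u + \<sigma> * z - u0))) \<partial>?N) \<le> ennreal (exp ((t + 1)\<^sup>2 * B))"
    using assms st s2 by (intro exponential_moment_le) (auto simp: algebra_simps simp del: real_sqrt_ge_1_iff)
  have m2: "(\<integral>\<^sup>+z. ennreal (exp (- (sqrt 2 * t + 1) * (u + \<sigma> * z - u0))) \<partial>?N) \<le> ennreal (exp ((t + 1)\<^sup>2 * B))"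
    using assms st s2 by (intro exponential_moment_le) (auto simp: algebra_simps simp del: real_sqrt_ge_1_iff)
  show "(\<integral>\<^sup>+z. ennreal ((cmod (kern u0 \<sigma>0 t (u + \<sigma> * z)))\<^sup>2) \<partial>?N)
      \<le> ennreal ((8 + 2 * t\<^sup>2 * \<sigma>0 ^ 4) * exp ((t + 1)\<^sup>2 * B))"
    unfolding norm_kern_sq
  proof (rule order_trans[OF m0], rule ennreal_leI)
    have "1 * exp ((t + 1)\<^sup>2 * B) \<le> (8 + 2 * t\<^sup>2 * \<sigma>0 ^ 4) * exp ((t + 1)\<^sup>2 * B)"
      by (intro mult_right_mono) (auto intro: order_trans[of _ 8])
    then show "exp ((t + 1)\<^sup>2 * B) \<le> (8 + 2 * t\<^sup>2 * \<sigma>0 ^ 4) * exp ((t + 1)\<^sup>2 * B)" by simp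
  qed
  define e1 where "e1 = (\<lambda>z. exp (- (sqrt 2 * t - 1) * (u + \<sigma> * z - u0)))"
  define e2 where "e2 = (\<lambda>z. exp (- (sqrt 2 * t + 1) * (u + \<sigma> * z - u0)))"
  define e3 where "e3 = (\<lambda>z. exp (- (sqrt 2 * t) * (u + \<sigma> * z - u0)))"
  define c where "c = 2 * t\<^sup>2 * \<sigma>0 ^ 4"
  have c0: "0 \<le> c" by (simp add: c_def)
  have [measurable]: "e1 \<in> borel_measurable borel" "e2 \<in> borel_measurable borel" "e3 \<in> borel_measurable borel"
    by (auto simp: e1_def e2_def e3_def)
  have e0: "0 \<le> e1 z" "0 \<le> e2 z" "0 \<le> e3 z" for z by (auto simp: e1_def e2_def e3_def)
  have "(\<integral>\<^sup>+z. ennreal ((cmod (kern_deriv u0 \<sigma>0 t (u + \<sigma> * z)))\<^sup>2) \<partial>?N)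
      \<le> (\<integral>\<^sup>+z. ennreal (4 * e1 z + 4 * e2 z + c * e3 z) \<partial>?N)"
    unfolding e1_def e2_def e3_def c_def by (intro nn_integral_mono ennreal_leI norm_kern_deriv_sq_le)
  also have "\<dots> = (\<integral>\<^sup>+z. ennreal 4 * ennreal (e1 z) + ennreal 4 * ennreal (e2 z) + ennreal c * ennreal (e3 z) \<partial>?N)"
    using e0 c0 by (intro nn_integral_cong) (simp add: ennreal_mult)
  also have "\<dots> = ennreal 4 * (\<integral>\<^sup>+z. ennreal (e1 z) \<partial>?N) + ennreal 4 * (\<integral>\<^sup>+z. ennreal (e2 z) \<partial>?N)
      + ennreal c * (\<integral>\<^sup>+z. ennreal (e3 z) \<partial>?N)"
    by (simp add: nn_integral_add nn_integral_cmult)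
  also have "\<dots> \<le> ennreal 4 * ennreal (exp ((t + 1)\<^sup>2 * B)) + ennreal 4 * ennreal (exp ((t + 1)\<^sup>2 * B))
       + ennreal c * ennreal (exp ((t + 1)\<^sup>2 * B))"
    using m0 m1 m2 unfolding e1_def e2_def e3_def by (intro add_mono mult_left_mono) auto
  also have "\<dots> = ennreal (4 * exp ((t + 1)\<^sup>2 * B) + 4 * exp ((t + 1)\<^sup>2 * B) + c * exp ((t + 1)\<^sup>2 * B))"
    using c0 by (simp only: ennreal_plus ennreal_mult add_nonneg_nonneg mult_nonneg_nonneg zero_le_numeral exp_ge_zero)
  also have "4 * exp ((t + 1)\<^sup>2 * B) + 4 * exp ((t + 1)\<^sup>2 * B) + c * exp ((t + 1)\<^sup>2 * B)
      = (8 + 2 * t\<^sup>2 * \<sigma>0 ^ 4) * exp ((t + 1)\<^sup>2 * B)"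
    by (simp add: c_def algebra_simps)
  finally show "(\<integral>\<^sup>+z. ennreal ((cmod (kern_deriv u0 \<sigma>0 t (u + \<sigma> * z)))\<^sup>2) \<partial>?N)
     \<le> ennreal ((8 + 2 * t\<^sup>2 * \<sigma>0 ^ 4) * exp ((t + 1)\<^sup>2 * B))" .
qed

section \<open>Concentration of the estimator\<close>

text \<open>A common bound for the second moments of \<open>kern\<close> and \<open>kern_deriv\<close> under the sampling
distribution. It keeps the weight \<open>\<epsilon>\<close> in front of the contribution of the wide components; the
final rate depends on this factor.\<close>

definition moment_bound :: "real \<Rightarrow> real \<Rightarrow> real \<Rightarrow> real \<Rightarrow> real" where
  "moment_bound \<sigma>0 A t \<epsilon> =
     (8 + 2 * t\<^sup>2 * \<sigma>0 ^ 4) * (exp ((t + 1)\<^sup>2 * \<sigma>0\<^sup>2) + \<epsilon> * exp ((t + 1)\<^sup>2 * A))"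

context
  fixes u0 \<sigma>0 A t \<epsilon> :: real and H :: "(real \<times> real) measure" and M :: "real measure"
  assumes H: "prob_space H" "sets H = sets borel" "AE p in H. 0 < snd p"
    and supp: "AE p in H. u0 < fst p \<and> (snd p)\<^sup>2 \<le> A"
    and \<epsilon>: "0 < \<epsilon>" "\<epsilon> < 1/2" and t: "1 \<le> t" and \<sigma>0: "0 < \<sigma>0"
  defines "M \<equiv> gaussian_mixture (contaminated_mixing \<epsilon> (u0, \<sigma>0) H)"
begin

lemma integrable_mix_terms: "integrable H (mix_term u0 \<sigma>0 t)" "integrable H (mix_term_deriv u0 \<sigma>0 t)"
proof -
  interpret H: prob_space H by (rule H(1))
  have le: "0 \<le> t * (fst p - u0)" if "u0 < fst p" for p :: "real \<times> real"
    using that t by simp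
  show "integrable H (mix_term u0 \<sigma>0 t)"
  proof (rule H.integrable_const_bound[where B=1])
    show "AE p in H. cmod (mix_term u0 \<sigma>0 t p) \<le> 1"
      using supp by eventually_elim (auto simp: norm_mix_term intro!: divide_nonneg_nonneg dest!: le)
  qed (rule mix_term_measurable[OF H(2)])
  show "integrable H (mix_term_deriv u0 \<sigma>0 t)"
  proof (rule H.integrable_const_bound[where B="2 + t * (A + \<sigma>0\<^sup>2)"])
    show "AE p in H. cmod (mix_term_deriv u0 \<sigma>0 t p) \<le> 2 + t * (A + \<sigma>0\<^sup>2)"
      using supp
    proof eventually_elim
      case (elim p)
      let ?d = "fst p - u0" and ?e = "exp (- (t * (fst p - u0)) / sqrt 2)"
      have "?d * ?e \<le> (t * ?d) * ?e" using elim t by (intro mult_right_mono) auto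
      also have "\<dots> \<le> 2" using mult_exp_neg_le[OF le[of p]] elim by simp
      finally have 1: "?d * ?e \<le> 2" .
      have "\<bar>(snd p)\<^sup>2 - \<sigma>0\<^sup>2\<bar> \<le> A + \<sigma>0\<^sup>2" 
        using elim zero_le_power2[of "snd p"] zero_le_power2[of \<sigma>0] unfolding abs_le_iff by linarith
      then have "\<bar>t\<bar> * \<bar>(snd p)\<^sup>2 - \<sigma>0\<^sup>2\<bar> * ?e \<le> t * (A + \<sigma>0\<^sup>2) * 1"
        using t elim le[of p] by (intro mult_mono) auto
      with 1 norm_mix_term_deriv_le[of u0 p \<sigma>0 t] elim show ?case by (simp add: algebra_simps)
    qed
  qed (rule mix_term_measurable[OF H(2)])
qed

lemma contaminated_facts:
  "prob_space (contaminated_mixing \<epsilon> (u0, \<sigma>0) H)" "sets (contaminated_mixing \<epsilon> (u0, \<sigma>0) H) = sets borel"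
  "f \<in> borel_measurable H \<Longrightarrow> (\<integral>\<^sup>+p. f p \<partial>contaminated_mixing \<epsilon> (u0, \<sigma>0) H) = ennreal (1 - \<epsilon>) * f (u0, \<sigma>0) + ennreal \<epsilon> * (\<integral>\<^sup>+p. f p \<partial>H)"
  "integrable H g \<Longrightarrow> (CLINT p|contaminated_mixing \<epsilon> (u0, \<sigma>0) H. g p) = of_real (1 - \<epsilon>) * g (u0, \<sigma>0) + of_real \<epsilon> * (CLINT p|H. g p)"
proof -
  have p0: "(u0, \<sigma>0) \<in> space H" using sets_eq_imp_space_eq[OF H(2)] by simp
  have e: "0 \<le> \<epsilon>" "\<epsilon> \<le> 1" using \<epsilon> by auto
  note cm = contaminated_mixing[OF H(1) p0 e]
  show "prob_space (contaminated_mixing \<epsilon> (u0, \<sigma>0) H)" "sets (contaminated_mixing \<epsilon> (u0, \<sigma>0) H) = sets borel"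
    using cm(1,2) H(2) by auto
  show "f \<in> borel_measurable H \<Longrightarrow> (\<integral>\<^sup>+p. f p \<partial>contaminated_mixing \<epsilon> (u0, \<sigma>0) H) = ennreal (1 - \<epsilon>) * f (u0, \<sigma>0) + ennreal \<epsilon> * (\<integral>\<^sup>+p. f p \<partial>H)"
    by (rule cm(3))
  show "integrable H g \<Longrightarrow> (CLINT p|contaminated_mixing \<epsilon> (u0, \<sigma>0) H. g p) = of_real (1 - \<epsilon>) * g (u0, \<sigma>0) + of_real \<epsilon> * (CLINT p|H. g p)"
    by (rule cm(4))
qed

lemma prob_space_M: "prob_space M" and sets_M: "sets M = sets borel"
  unfolding M_def using prob_space_gaussian_mixture[OF contaminated_facts(1,2)] by auto

lemma nn_integral_M_le:
  assumes g[measurable]: "g \<in> borel_measurable borel" and Q: "0 \<le> Q"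
    and bound: "\<And>u \<sigma> B. u0 \<le> u \<Longrightarrow> \<sigma>\<^sup>2 \<le> B \<Longrightarrow>
      (\<integral>\<^sup>+z. g (u + \<sigma> * z) \<partial>std_normal_distribution) \<le> ennreal (Q * exp ((t + 1)\<^sup>2 * B))"
  shows "(\<integral>\<^sup>+x. g x \<partial>M) \<le> ennreal (Q * (exp ((t + 1)\<^sup>2 * \<sigma>0\<^sup>2) + \<epsilon> * exp ((t + 1)\<^sup>2 * A)))"
proof -
  interpret H: prob_space H by (rule H(1))
  interpret N: prob_space std_normal_distribution by (rule prob_space_normal_density) simp
  have sH[measurable_cong]: "sets H = sets (borel \<Otimes>\<^sub>M borel)" by (simp only: H(2) borel_prod)
  let ?G = "\<lambda>p. \<integral>\<^sup>+z. g (fst p + snd p * z) \<partial>std_normal_distribution"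
  have Gm: "?G \<in> borel_measurable H" by (intro N.borel_measurable_nn_integral) measurable
  have "(\<integral>\<^sup>+p. ?G p \<partial>H) \<le> (\<integral>\<^sup>+p. ennreal (Q * exp ((t + 1)\<^sup>2 * A)) \<partial>H)"
  proof (rule nn_integral_mono_AE)
    show "AE p in H. ?G p \<le> ennreal (Q * exp ((t + 1)\<^sup>2 * A))"
      using supp by eventually_elim (simp add: bound)
  qed
  then have 1: "(\<integral>\<^sup>+p. ?G p \<partial>H) \<le> ennreal (Q * exp ((t + 1)\<^sup>2 * A))" by (simp add: H.emeasure_space_1)
  have 2: "?G (u0, \<sigma>0) \<le> ennreal (Q * exp ((t + 1)\<^sup>2 * \<sigma>0\<^sup>2))" using bound[of u0 \<sigma>0 "\<sigma>0\<^sup>2"] by simp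
  have "(\<integral>\<^sup>+x. g x \<partial>M) = ennreal (1 - \<epsilon>) * ?G (u0, \<sigma>0) + ennreal \<epsilon> * (\<integral>\<^sup>+p. ?G p \<partial>H)"
    unfolding M_def nn_integral_gaussian_mixture[OF contaminated_facts(2) g] by (rule contaminated_facts(3)[OF Gm])
  also have "\<dots> \<le> ennreal 1 * ennreal (Q * exp ((t + 1)\<^sup>2 * \<sigma>0\<^sup>2)) + ennreal \<epsilon> * ennreal (Q * exp ((t + 1)\<^sup>2 * A))"
    using \<epsilon> 1 2 by (intro add_mono mult_mono ennreal_leI) auto
  also have "\<dots> = ennreal (1 * (Q * exp ((t + 1)\<^sup>2 * \<sigma>0\<^sup>2)) + \<epsilon> * (Q * exp ((t + 1)\<^sup>2 * A)))"
    using \<epsilon> Q by (subst ennreal_plus) (auto simp: ennreal_mult)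
  finally show ?thesis by (simp add: algebra_simps)
qed

lemma second_moments_M:
  "(\<integral>\<^sup>+x. ennreal ((cmod (kern u0 \<sigma>0 t x))\<^sup>2) \<partial>M) \<le> ennreal (moment_bound \<sigma>0 A t \<epsilon>)"
  "(\<integral>\<^sup>+x. ennreal ((cmod (kern_deriv u0 \<sigma>0 t x))\<^sup>2) \<partial>M) \<le> ennreal (moment_bound \<sigma>0 A t \<epsilon>)"
  unfolding moment_bound_def
  by (rule nn_integral_M_le; (rule second_moments_normal)?; use t in \<open>simp\<close>)+

lemma square_integrable_M:
  assumes [measurable]: "g \<in> borel_measurable borel" and "(\<integral>\<^sup>+x. ennreal ((cmod (g x))\<^sup>2) \<partial>M) \<le> ennreal V"
  shows "integrable M g"
proof -
  interpret M: prob_space M by (rule prob_space_M)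
  have m[measurable]: "g \<in> borel_measurable M" using measurable_cong_sets[OF sets_M refl] assms(1) by blast
  have "integrable M (\<lambda>x. (cmod (g x))\<^sup>2)"
    using assms(2) by (intro integrableI_bounded) (auto intro: le_less_trans)
  then have "integrable M (\<lambda>x. g x ^ 2)"
    by (rule Bochner_Integration.integrable_bound) (auto simp: norm_power)
  then show ?thesis by (rule M.square_integrable_imp_integrable[OF m])
qed

lemma expectations_M:
  "(CLINT x|M. kern u0 \<sigma>0 t x) = of_real (1 - \<epsilon>) + of_real \<epsilon> * (CLINT p|H. mix_term u0 \<sigma>0 t p)"
  "(CLINT x|M. kern_deriv u0 \<sigma>0 t x) = of_real \<epsilon> * (CLINT p|H. mix_term_deriv u0 \<sigma>0 t p)"
proof -
  have i: "integrable M (kern u0 \<sigma>0 t)" "integrable M (kern_deriv u0 \<sigma>0 t)"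
    by (rule square_integrable_M[OF _ second_moments_M(1)], simp) (rule square_integrable_M[OF _ second_moments_M(2)], simp)
  have "(CLINT x|M. kern u0 \<sigma>0 t x) = (CLINT p|contaminated_mixing \<epsilon> (u0, \<sigma>0) H. mix_term u0 \<sigma>0 t p)"
    using integral_gaussian_mixture[OF contaminated_facts(1,2) i(1)[unfolded M_def]]
    by (simp add: M_def expectation_kern)
  also have "\<dots> = of_real (1 - \<epsilon>) * mix_term u0 \<sigma>0 t (u0, \<sigma>0) + of_real \<epsilon> * (CLINT p|H. mix_term u0 \<sigma>0 t p)"
    by (rule contaminated_facts(4)[OF integrable_mix_terms(1)])
  also have "mix_term u0 \<sigma>0 t (u0, \<sigma>0) = 1" by (simp add: mix_term_def)
  finally show "(CLINT x|M. kern u0 \<sigma>0 t x) = of_real (1 - \<epsilon>) + of_real \<epsilon> * (CLINT p|H. mix_term u0 \<sigma>0 t p)" by simp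
  have "(CLINT x|M. kern_deriv u0 \<sigma>0 t x) = (CLINT p|contaminated_mixing \<epsilon> (u0, \<sigma>0) H. mix_term_deriv u0 \<sigma>0 t p)"
    using integral_gaussian_mixture[OF contaminated_facts(1,2) i(2)[unfolded M_def]]
    by (simp add: M_def expectation_kern_deriv)
  also have "\<dots> = of_real (1 - \<epsilon>) * mix_term_deriv u0 \<sigma>0 t (u0, \<sigma>0) + of_real \<epsilon> * (CLINT p|H. mix_term_deriv u0 \<sigma>0 t p)"
    by (rule contaminated_facts(4)[OF integrable_mix_terms(2)])
  also have "mix_term_deriv u0 \<sigma>0 t (u0, \<sigma>0) = 0" by (simp add: mix_term_deriv_def)
  finally show "(CLINT x|M. kern_deriv u0 \<sigma>0 t x) = of_real \<epsilon> * (CLINT p|H. mix_term_deriv u0 \<sigma>0 t p)" by simp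
qed

lemma sample_law_eq: "sample_law u0 \<sigma>0 n \<epsilon> H = (\<Pi>\<^sub>M j\<in>{1..n}. M)"
  using density_mix_density[OF H, of \<epsilon> \<sigma>0 u0] \<epsilon> \<sigma>0 by (simp add: sample_law_def M_def)

text \<open>Outside two Chebyshev events, for the normalized empirical transform and for its derivative, the
deterministic estimate applies. The derivative must be controlled at the finer scale \<open>\<theta>\<epsilon>/t\<close>, hence
the factor \<open>1 + t\<^sup>2\<close>.\<close>

lemma emeasure_bad_sample_le:
  fixes uh sh :: "(nat \<Rightarrow> real) \<Rightarrow> real"
  assumes n: "0 < n" and \<theta>: "0 < \<theta>" "\<theta> \<le> 1/16" "38 * \<theta> \<le> \<eta>"
    and m0: "cmod (CLINT p|H. mix_term u0 \<sigma>0 t p) \<le> \<theta>"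
    and m1: "t * cmod (CLINT p|H. mix_term_deriv u0 \<sigma>0 t p) \<le> \<theta>"
    and uh: "\<And>x. x \<in> space (\<Pi>\<^sub>M j\<in>{1..n}. (borel :: real measure)) \<Longrightarrow> gen_ecf n x t \<noteq> 0 \<Longrightarrow> uh x = u0_fun (gen_ecf n x) t"
    and sh: "\<And>x. x \<in> space (\<Pi>\<^sub>M j\<in>{1..n}. (borel :: real measure)) \<Longrightarrow> gen_ecf n x t \<noteq> 0 \<Longrightarrow> sh x = sigma0sq_fun (gen_ecf n x) t"
  shows "emeasure (sample_law u0 \<sigma>0 n \<epsilon> H)
      {x \<in> space (sample_law u0 \<sigma>0 n \<epsilon> H). cmod (eps_fun (gen_ecf n x) t (uh x) (sh x) / of_real \<epsilon> - 1) > \<eta>}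
    \<le> ennreal ((1 + t\<^sup>2) * moment_bound \<sigma>0 A t \<epsilon> / (real n * (\<theta> * \<epsilon>)\<^sup>2))"
proof -
  let ?P = "\<Pi>\<^sub>M j\<in>{1..n}. M"
  let ?V = "moment_bound \<sigma>0 A t \<epsilon>"
  have V0: "0 \<le> ?V" using \<epsilon> by (auto simp: moment_bound_def intro!: mult_nonneg_nonneg add_nonneg_nonneg)
  define G where "G = (\<lambda>x s. (\<Sum>j=1..n. kern u0 \<sigma>0 s (x j)) / of_nat n)"
  define G1 where "G1 = (\<lambda>x. (\<Sum>j=1..n. kern_deriv u0 \<sigma>0 t (x j)) / of_nat n)"
  have [measurable_cong]: "sets M = sets borel" by (rule sets_M)
  let ?B0 = "{x \<in> space ?P. \<theta> * \<epsilon> \<le> cmod (G x t - (CLINT x|M. kern u0 \<sigma>0 t x))}"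
  let ?B1 = "{x \<in> space ?P. \<theta> * \<epsilon> / t \<le> cmod (G1 x - (CLINT x|M. kern_deriv u0 \<sigma>0 t x))}"
  have kM: "kern u0 \<sigma>0 t \<in> borel_measurable M" "kern_deriv u0 \<sigma>0 t \<in> borel_measurable M" by measurable
  have B0m[measurable]: "?B0 \<in> sets ?P" unfolding G_def by measurable
  have B1m[measurable]: "?B1 \<in> sets ?P" unfolding G1_def by measurable
  have sub: "{x \<in> space ?P. cmod (eps_fun (gen_ecf n x) t (uh x) (sh x) / of_real \<epsilon> - 1) > \<eta>} \<subseteq> ?B0 \<union> ?B1"
  proof (rule subsetI, rule ccontr)
    fix x assume x: "x \<in> {x \<in> space ?P. cmod (eps_fun (gen_ecf n x) t (uh x) (sh x) / of_real \<epsilon> - 1) > \<eta>}"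
      and "x \<notin> ?B0 \<union> ?B1"
    then have b0: "cmod (G x t - (CLINT x|M. kern u0 \<sigma>0 t x)) < \<theta> * \<epsilon>"
      and b1: "cmod (G1 x - (CLINT x|M. kern_deriv u0 \<sigma>0 t x)) < \<theta> * \<epsilon> / t" by auto
    have xs: "x \<in> space (\<Pi>\<^sub>M j\<in>{1..n}. (borel :: real measure))"
      using x sets_eq_imp_space_eq[OF sets_M] by (simp add: space_PiM)
    have Gd: "((\<lambda>s. G x s) has_vector_derivative G1 x) (at t)"
      unfolding G_def G1_def divide_inverse
      by (intro has_vector_derivative_mult_left has_vector_derivative_sum kern_has_vector_derivative)
    have "cmod (G x t - of_real (1 - \<epsilon>)) \<le> cmod (G x t - (CLINT x|M. kern u0 \<sigma>0 t x)) + cmod (of_real \<epsilon> * (CLINT p|H. mix_term u0 \<sigma>0 t p))"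
    proof -
      have eq: "G x t - of_real (1 - \<epsilon>) = (G x t - (CLINT x|M. kern u0 \<sigma>0 t x)) + of_real \<epsilon> * (CLINT p|H. mix_term u0 \<sigma>0 t p)"
        by (simp add: expectations_M(1))
      show ?thesis by (subst eq) (rule norm_triangle_ineq)
    qed
    also have "\<dots> \<le> \<theta> * \<epsilon> + \<epsilon> * \<theta>"
      using b0 m0 \<epsilon> unfolding norm_mult by (intro add_mono mult_mono) auto
    also have "\<dots> = 2 * \<theta> * \<epsilon>" by simp
    finally have c0: "cmod (G x t - of_real (1 - \<epsilon>)) \<le> 2 * \<theta> * \<epsilon>" .
    have "cmod (G1 x) \<le> cmod (G1 x - (CLINT x|M. kern_deriv u0 \<sigma>0 t x)) + cmod (of_real \<epsilon> * (CLINT p|H. mix_term_deriv u0 \<sigma>0 t p))"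
    proof -
      have eq: "G1 x = (G1 x - (CLINT x|M. kern_deriv u0 \<sigma>0 t x)) + of_real \<epsilon> * (CLINT p|H. mix_term_deriv u0 \<sigma>0 t p)"
        by (simp add: expectations_M(2))
      show ?thesis by (subst eq) (rule norm_triangle_ineq)
    qed
    then have "t * cmod (G1 x) \<le> t * (cmod (G1 x - (CLINT x|M. kern_deriv u0 \<sigma>0 t x)) + cmod (of_real \<epsilon> * (CLINT p|H. mix_term_deriv u0 \<sigma>0 t p)))"
      using t by (intro mult_left_mono) auto
    also have "\<dots> = t * cmod (G1 x - (CLINT x|M. kern_deriv u0 \<sigma>0 t x)) + \<epsilon> * (t * cmod (CLINT p|H. mix_term_deriv u0 \<sigma>0 t p))"
      using \<epsilon> by (simp add: norm_mult distrib_left)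
    also have "\<dots> \<le> \<theta> * \<epsilon> + \<epsilon> * \<theta>"
      using b1 m1 \<epsilon> t by (intro add_mono mult_left_mono) (auto simp: field_simps)
    also have "\<dots> = 2 * \<theta> * \<epsilon>" by simp
    finally have c1: "t * cmod (G1 x) \<le> 2 * \<theta> * \<epsilon>" .
    have g: "gen_ecf n x s = ref_cf u0 \<sigma>0 s * G x s" for s
      unfolding G_def by (rule gen_ecf_factor)
    have t0: "0 < t" and th0: "0 \<le> \<theta>" using t \<theta> by auto
    note det = eps_estimate_deterministic[where g = "gen_ecf n x", OF g Gd t0 \<epsilon> th0 \<theta>(2) c0 c1]
    have "cmod (eps_fun (gen_ecf n x) t (uh x) (sh x) / of_real \<epsilon> - 1) \<le> 38 * \<theta>"
      using det(2) uh[OF xs det(1)] sh[OF xs det(1)] by simp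
    with x \<theta>(3) show False by simp
  qed
  have "emeasure ?P {x \<in> space ?P. cmod (eps_fun (gen_ecf n x) t (uh x) (sh x) / of_real \<epsilon> - 1) > \<eta>} \<le> emeasure ?P (?B0 \<union> ?B1)"
    by (rule emeasure_mono[OF sub]) measurable
  also have "\<dots> \<le> emeasure ?P ?B0 + emeasure ?P ?B1"
    by (rule emeasure_subadditive[OF B0m B1m])
  also have "\<dots> \<le> ennreal (?V / (real n * (\<theta> * \<epsilon>)\<^sup>2)) + ennreal (?V / (real n * (\<theta> * \<epsilon> / t)\<^sup>2))"
  proof (rule add_mono)
    show "emeasure ?P ?B0 \<le> ennreal (?V / (real n * (\<theta> * \<epsilon>)\<^sup>2))"
      unfolding G_def by (rule chebyshev_sample_mean[OF prob_space_M kM(1) second_moments_M(1) n _ V0]) (use \<theta> \<epsilon> in simp)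
    show "emeasure ?P ?B1 \<le> ennreal (?V / (real n * (\<theta> * \<epsilon> / t)\<^sup>2))"
      unfolding G1_def by (rule chebyshev_sample_mean[OF prob_space_M kM(2) second_moments_M(2) n _ V0]) (use \<theta> \<epsilon> t in simp)
  qed
  also have "\<dots> = ennreal (?V / (real n * (\<theta> * \<epsilon>)\<^sup>2) + ?V / (real n * (\<theta> * \<epsilon> / t)\<^sup>2))"
    using V0 by (intro ennreal_plus[symmetric]) auto
  also have "?V / (real n * (\<theta> * \<epsilon>)\<^sup>2) + ?V / (real n * (\<theta> * \<epsilon> / t)\<^sup>2) = (1 + t\<^sup>2) * ?V / (real n * (\<theta> * \<epsilon>)\<^sup>2)"
    using n \<theta> \<epsilon> t by (simp add: field_simps)
  finally show ?thesis by (simp add: sample_law_eq)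
qed

end

section \<open>Vanishing bias\<close>

text \<open>Under separation every component carries the factor \<open>exp(-t\<delta>/\<surd>2)\<close> with \<open>\<delta> > d\<close>. In the derivative
the factor \<open>t\<delta>\<close> uses up \<open>exp(-t\<delta>/2)\<close>, and the remaining factor is at most \<open>exp(-t\<delta>/5)\<close>.\<close>

lemma separated_mix_terms:
  assumes H: "prob_space H"
    and supp: "AE p in H. u0 < fst p \<and> (snd p)\<^sup>2 \<le> A"
    and d: "AE p in H. u0 + d < fst p" "0 \<le> d" and t: "1 \<le> t"
  shows "cmod (CLINT p|H. mix_term u0 \<sigma>0 t p) \<le> exp (- (t * d) / sqrt 2)"
    and "t * cmod (CLINT p|H. mix_term_deriv u0 \<sigma>0 t p)
           \<le> 2 * exp (- (t * d) / 5) + t\<^sup>2 * (A + \<sigma>0\<^sup>2) * exp (- (t * d) / sqrt 2)"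
proof -
  interpret H: prob_space H by (rule H)
  have sq: "1 / 2 + 1 / 5 \<le> 1 / sqrt 2"
  proof -
    have "sqrt 2 \<le> 10 / 7" by (rule real_le_lsqrt) (auto simp: power2_eq_square)
    then show ?thesis by (simp add: field_simps)
  qed
  have bound: "cmod (CLINT p|H. g p) \<le> B"
    if g: "AE p in H. cmod (g p) \<le> B" "0 \<le> B" for g :: "real \<times> real \<Rightarrow> complex" and B
  proof -
    have "cmod (CLINT p|H. g p) \<le> (LINT p|H. cmod (g p))" by (rule integral_norm_bound)
    also have "\<dots> \<le> (LINT p|H. B)"
      by (rule integral_mono_AE') (use g in \<open>auto simp: H.prob_space\<close>)
    finally show ?thesis by (simp add: H.prob_space)
  qed
  have mono: "exp (- (t * (fst p - u0)) / sqrt 2) \<le> exp (- (t * d) / sqrt 2)" if "u0 + d < fst p" for p :: "real \<times> real"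
    using that t by (simp add: divide_right_mono)
  show "cmod (CLINT p|H. mix_term u0 \<sigma>0 t p) \<le> exp (- (t * d) / sqrt 2)"
  proof (rule bound)
    show "AE p in H. cmod (mix_term u0 \<sigma>0 t p) \<le> exp (- (t * d) / sqrt 2)"
      using d(1) unfolding norm_mix_term by eventually_elim (rule mono)
  qed simp
  let ?B = "2 * exp (- (t * d) / 5) + t\<^sup>2 * (A + \<sigma>0\<^sup>2) * exp (- (t * d) / sqrt 2)"
  have A0: "0 \<le> A"
  proof -
    have "AE p in H. 0 \<le> A" using supp by eventually_elim (auto intro: order_trans[OF zero_le_power2])
    then show ?thesis by simp
  qed
  have "cmod (CLINT p|H. mix_term_deriv u0 \<sigma>0 t p) \<le> ?B / t"
  proof (rule bound)
    show "0 \<le> ?B / t" using A0 t by (intro divide_nonneg_nonneg add_nonneg_nonneg mult_nonneg_nonneg) auto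
    show "AE p in H. cmod (mix_term_deriv u0 \<sigma>0 t p) \<le> ?B / t"
      using supp d(1)
    proof eventually_elim
      case (elim p)
      define y where "y = t * (fst p - u0)"
      have y: "t * d \<le> y" using elim t by (simp add: y_def)
      have y0: "0 \<le> y" using t d(2) by (intro order_trans[OF _ y]) simp
      have "y \<le> 2 * exp (y / 2)" using exp_ge_add_one_self[of "y / 2"] by linarith
      then have "y * exp (- y / sqrt 2) \<le> 2 * exp (y / 2) * exp (- y / sqrt 2)" by (intro mult_right_mono) auto
      also have "\<dots> = 2 * exp (y * (1/2 - 1 / sqrt 2))" by (simp add: exp_add[symmetric] algebra_simps)
      also have "\<dots> \<le> 2 * exp (- (t * d) / 5)"
      proof -
        have "y * (1/2 - 1 / sqrt 2) \<le> y * (- (1 / 5))" using y0 sq by (intro mult_left_mono) auto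
        then show ?thesis using y by simp
      qed
      finally have 1: "y * exp (- y / sqrt 2) \<le> 2 * exp (- (t * d) / 5)" .
      have "\<bar>(snd p)\<^sup>2 - \<sigma>0\<^sup>2\<bar> \<le> A + \<sigma>0\<^sup>2"
        using elim zero_le_power2[of "snd p"] zero_le_power2[of \<sigma>0] unfolding abs_le_iff by linarith
      then have a: "t\<^sup>2 * \<bar>(snd p)\<^sup>2 - \<sigma>0\<^sup>2\<bar> \<le> t\<^sup>2 * (A + \<sigma>0\<^sup>2)" by (rule mult_left_mono) simp
      have m: "exp (- y / sqrt 2) \<le> exp (- (t * d) / sqrt 2)" unfolding y_def by (rule mono[OF elim(2)])
      have 2: "t\<^sup>2 * \<bar>(snd p)\<^sup>2 - \<sigma>0\<^sup>2\<bar> * exp (- y / sqrt 2) \<le> t\<^sup>2 * (A + \<sigma>0\<^sup>2) * exp (- (t * d) / sqrt 2)"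
        by (rule mult_mono[OF a m]) (use A0 in simp_all)
      have "t * cmod (mix_term_deriv u0 \<sigma>0 t p) \<le> t * (((fst p - u0) + \<bar>t\<bar> * \<bar>(snd p)\<^sup>2 - \<sigma>0\<^sup>2\<bar>) * exp (- y / sqrt 2))"
        unfolding y_def using elim t by (intro mult_left_mono norm_mix_term_deriv_le) auto
      also have "\<dots> = y * exp (- y / sqrt 2) + t\<^sup>2 * \<bar>(snd p)\<^sup>2 - \<sigma>0\<^sup>2\<bar> * exp (- y / sqrt 2)"
        using t by (simp add: y_def power2_eq_square algebra_simps)
      also have "\<dots> \<le> ?B" using 1 2 by (rule add_mono)
      finally show ?case using t by (simp add: field_simps)
    qed
  qed
  then show "t * cmod (CLINT p|H. mix_term_deriv u0 \<sigma>0 t p) \<le> ?B"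
    using t by (simp add: field_simps)
qed

text \<open>The component means, expressed in the coordinates \<open>(\<delta>, \<kappa>)\<close> in which the smoothness hypothesis is
stated.\<close>

definition char_term :: "real \<Rightarrow> real \<times> real \<Rightarrow> complex" where
  "char_term t q = exp (omega * of_real (t * fst q) + \<i> * of_real (t\<^sup>2 * snd q))"

definition char_term_deriv :: "real \<Rightarrow> real \<times> real \<Rightarrow> complex" where
  "char_term_deriv t q = (omega * of_real (fst q) + 2 * \<i> * of_real (t * snd q)) * char_term t q"

text \<open>Integrating \<open>exp(it\<^sup>2\<kappa>)\<close> over the conditional law of \<open>\<kappa>\<close> gives its Fourier transform at \<open>t\<^sup>2\<close>. The
factor \<open>\<kappa>\<close> in the derivative term turns it into the derivative of that transform, and the bounded
range of \<open>\<kappa>\<close> justifies differentiating under the integral. The prefactor \<open>t\<^sup>2\<close> is compensated by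
the additional power in the derivative bound.\<close>

lemma conditional_char_terms:
  fixes f :: "real \<times> real \<Rightarrow> real"
  assumes f0: "\<And>p. 0 \<le> f p" and fint: "integrable lborel (\<lambda>\<kappa>. f (\<delta>, \<kappa>))"
    and supp: "AE \<kappa> in lborel. 0 < f (\<delta>, \<kappa>) \<longrightarrow> 0 < \<delta> \<and> \<bar>\<kappa>\<bar> \<le> K"
    and FT: "0 < marginal_density f \<delta> \<Longrightarrow>
       cmod (cond_FT f \<delta> (t\<^sup>2)) \<le> C * (1 + \<bar>t\<^sup>2\<bar>) powr (- \<alpha>) \<and>
       (\<exists>D. (cond_FT f \<delta> has_vector_derivative D) (at (t\<^sup>2)) \<and> cmod D \<le> C * (1 + \<bar>t\<^sup>2\<bar>) powr (- (\<alpha> + 1)))"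
    and t: "1 \<le> t" and C: "0 < C"
  shows "cmod (CLINT \<kappa>|lborel. f (\<delta>, \<kappa>) *\<^sub>R char_term t (\<delta>, \<kappa>)) \<le> marginal_density f \<delta> * (C * (1 + t\<^sup>2) powr (- \<alpha>))"
    and "t * cmod (CLINT \<kappa>|lborel. f (\<delta>, \<kappa>) *\<^sub>R char_term_deriv t (\<delta>, \<kappa>)) \<le> marginal_density f \<delta> * (4 * C * (1 + t\<^sup>2) powr (- \<alpha>))"
proof -
  let ?m = "marginal_density f \<delta>"
  have m0: "0 \<le> ?m" unfolding marginal_density_def using f0 by (intro Bochner_Integration.integral_nonneg) auto
  have goal: "cmod (CLINT \<kappa>|lborel. f (\<delta>, \<kappa>) *\<^sub>R char_term t (\<delta>, \<kappa>)) \<le> ?m * (C * (1 + t\<^sup>2) powr (- \<alpha>))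
    \<and> t * cmod (CLINT \<kappa>|lborel. f (\<delta>, \<kappa>) *\<^sub>R char_term_deriv t (\<delta>, \<kappa>)) \<le> ?m * (4 * C * (1 + t\<^sup>2) powr (- \<alpha>))"
  proof (cases "?m = 0")
    case True
    then have "AE \<kappa> in lborel. f (\<delta>, \<kappa>) = 0"
      using integral_nonneg_eq_0_iff_AE[OF fint] f0 by (simp add: marginal_density_def)
    then have "(CLINT \<kappa>|lborel. f (\<delta>, \<kappa>) *\<^sub>R g \<kappa>) = 0" for g :: "real \<Rightarrow> complex"
      by (intro integral_eq_zero_AE) (auto elim: eventually_mono)
    then show ?thesis using True by simp
  next
    case False
    with m0 have m: "0 < ?m" by simp
    have \<delta>: "0 < \<delta>"
    proof (rule ccontr)
      assume "\<not> 0 < \<delta>"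
      with supp f0 have "AE \<kappa> in lborel. f (\<delta>, \<kappa>) = 0" by (auto elim!: eventually_mono simp: less_le)
      then have "?m = 0" unfolding marginal_density_def by (rule integral_eq_zero_AE)
      with m show False by simp
    qed
    define h where "h = cond_density f \<delta>"
    have h: "h \<kappa> = f (\<delta>, \<kappa>) / ?m" for \<kappa> by (simp add: h_def cond_density_def)
    have hint: "integrable lborel h" unfolding h using fint by (simp add: h[abs_def])
    have [measurable]: "h \<in> borel_measurable lborel" using hint by auto
    have h2: "integrable lborel (\<lambda>\<kappa>. \<kappa>\<^sup>2 * h \<kappa>)"
    proof (rule Bochner_Integration.integrable_bound[OF integrable_mult_right[OF hint, of "K\<^sup>2"]])
      show "AE \<kappa> in lborel. norm (\<kappa>\<^sup>2 * h \<kappa>) \<le> norm (K\<^sup>2 * h \<kappa>)"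
        using supp
      proof eventually_elim
        case (elim \<kappa>)
        show ?case
        proof (cases "f (\<delta>, \<kappa>) = 0")
          case False
          with elim f0[of "(\<delta>, \<kappa>)"] have "\<bar>\<kappa>\<bar> \<le> K" by auto
          then have "\<kappa>\<^sup>2 \<le> K\<^sup>2" using power_mono[of "\<bar>\<kappa>\<bar>" K 2] by simp
          then show ?thesis by (simp add: abs_mult mult_right_mono)
        qed (simp add: h)
      qed
    qed simp
    define E where "E = exp (omega * of_real (t * \<delta>))"
    have nE: "cmod E = exp (- (t * \<delta>) / sqrt 2)" by (simp add: E_def Re_omega)
    define \<Phi> where "\<Phi> = cond_FT f \<delta> (t\<^sup>2)"
    define D where "D = (CLINT x|lborel. \<i> * of_real x * iexp (t\<^sup>2 * x) * of_real (h x))"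
    have FTeq: "cond_FT f \<delta> = (\<lambda>t. CLINT x|lborel. iexp (t * x) * of_real (h x))"
      by (simp add: cond_FT_def h_def fun_eq_iff)
    note der = fourier_integral_has_vector_derivative[OF hint h2, of "t\<^sup>2"]
    have b0: "cmod \<Phi> \<le> C * (1 + t\<^sup>2) powr (- \<alpha>)" using FT[OF m] by (simp add: \<Phi>_def)
    have b1: "cmod D \<le> C * (1 + t\<^sup>2) powr (- (\<alpha> + 1))"
    proof -
      obtain D' where D': "(cond_FT f \<delta> has_vector_derivative D') (at (t\<^sup>2))" "cmod D' \<le> C * (1 + \<bar>t\<^sup>2\<bar>) powr (- (\<alpha> + 1))"
        using FT[OF m] by blast
      \<comment> \<open>Any derivative provided by the hypothesis coincides with \<open>D\<close>, by uniqueness of derivatives.\<close>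
      have "D' = D" using vector_derivative_unique_at[OF D'(1)] der(2) unfolding FTeq D_def by blast
      with D'(2) show ?thesis by simp
    qed
    have fh: "f (\<delta>, \<kappa>) = ?m * h \<kappa>" for \<kappa> using m by (simp add: h)
    have ch: "char_term t (\<delta>, \<kappa>) = E * iexp (t\<^sup>2 * \<kappa>)" for \<kappa> by (simp add: char_term_def E_def exp_add)
    have i0: "integrable lborel (\<lambda>x. iexp (t\<^sup>2 * x) * of_real (h x))"
      by (rule Bochner_Integration.integrable_bound[OF hint]) (auto simp: norm_mult)
    have eq0: "f (\<delta>, \<kappa>) *\<^sub>R char_term t (\<delta>, \<kappa>) = (of_real ?m * E) * (iexp (t\<^sup>2 * \<kappa>) * of_real (h \<kappa>))" for \<kappa>
      unfolding fh ch by (simp add: scaleR_conv_of_real)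
    have I0: "(CLINT \<kappa>|lborel. f (\<delta>, \<kappa>) *\<^sub>R char_term t (\<delta>, \<kappa>)) = (of_real ?m * E) * \<Phi>"
      unfolding eq0 \<Phi>_def FTeq by (rule integral_mult_right_zero)
    have eq1: "f (\<delta>, \<kappa>) *\<^sub>R char_term_deriv t (\<delta>, \<kappa>)
       = (of_real ?m * E * omega * of_real \<delta>) * (iexp (t\<^sup>2 * \<kappa>) * of_real (h \<kappa>))
         + (of_real ?m * E * 2 * of_real t) * (\<i> * of_real \<kappa> * iexp (t\<^sup>2 * \<kappa>) * of_real (h \<kappa>))" for \<kappa>
      unfolding fh ch char_term_deriv_def by (simp add: scaleR_conv_of_real algebra_simps)
    have I1: "(CLINT \<kappa>|lborel. f (\<delta>, \<kappa>) *\<^sub>R char_term_deriv t (\<delta>, \<kappa>))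
        = (of_real ?m * E * omega * of_real \<delta>) * \<Phi> + (of_real ?m * E * 2 * of_real t) * D"
      unfolding eq1 \<Phi>_def FTeq D_def using i0 der(1)
      by (simp only: Bochner_Integration.integral_add integrable_mult_right integral_mult_right_zero)
    have E1: "cmod E \<le> 1" unfolding nE using t \<delta> by simp
    have "cmod (of_real ?m * E * \<Phi>) = ?m * (cmod E * cmod \<Phi>)" using m by (simp add: norm_mult)
    also have "\<dots> \<le> ?m * (1 * (C * (1 + t\<^sup>2) powr (- \<alpha>)))"
      using E1 b0 m by (intro mult_left_mono mult_mono) auto
    finally have R0: "cmod (CLINT \<kappa>|lborel. f (\<delta>, \<kappa>) *\<^sub>R char_term t (\<delta>, \<kappa>)) \<le> ?m * (C * (1 + t\<^sup>2) powr (- \<alpha>))"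
      unfolding I0 by simp
    let ?c = "C * (1 + t\<^sup>2) powr (- \<alpha>)"
    have "(t * \<delta>) * cmod E \<le> 2" unfolding nE using mult_exp_neg_le[of "t * \<delta>"] t \<delta> by simp
    then have x1: "((t * \<delta>) * cmod E) * cmod \<Phi> \<le> 2 * ?c" using b0 by (intro mult_mono) auto
    have "t\<^sup>2 * (1 + t\<^sup>2) powr (- (\<alpha> + 1)) \<le> (1 + t\<^sup>2) * (1 + t\<^sup>2) powr (- (\<alpha> + 1))" by (intro mult_right_mono) auto
    also have "\<dots> = (1 + t\<^sup>2) powr (- \<alpha>)"
      using powr_add[of "1 + t\<^sup>2" 1 "- (\<alpha> + 1)"] by (simp add: powr_one add_nonneg_nonneg)
    finally have "C * (t\<^sup>2 * (1 + t\<^sup>2) powr (- (\<alpha> + 1))) \<le> ?c" using C by (intro mult_left_mono) auto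
    moreover have "t\<^sup>2 * cmod D \<le> t\<^sup>2 * (C * (1 + t\<^sup>2) powr (- (\<alpha> + 1)))" using b1 by (intro mult_left_mono) auto
    ultimately have x2: "t\<^sup>2 * cmod D \<le> ?c" by (simp add: mult.left_commute)
    have x3: "cmod E * (t\<^sup>2 * cmod D) \<le> 1 * ?c" by (rule mult_mono[OF E1 x2]) auto
    have "t * cmod (CLINT \<kappa>|lborel. f (\<delta>, \<kappa>) *\<^sub>R char_term_deriv t (\<delta>, \<kappa>))
       \<le> t * (cmod ((of_real ?m * E * omega * of_real \<delta>) * \<Phi>) + cmod ((of_real ?m * E * 2 * of_real t) * D))"
      unfolding I1 using t by (intro mult_left_mono norm_triangle_ineq) auto
    also have "\<dots> = ?m * (((t * \<delta>) * cmod E) * cmod \<Phi> + 2 * (cmod E * (t\<^sup>2 * cmod D)))"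
      using m t \<delta> by (simp add: norm_mult power2_eq_square algebra_simps)
    also have "\<dots> \<le> ?m * (2 * ?c + 2 * (1 * ?c))"
      using m x1 x3 by (intro mult_left_mono add_mono) auto
    finally have R1: "t * cmod (CLINT \<kappa>|lborel. f (\<delta>, \<kappa>) *\<^sub>R char_term_deriv t (\<delta>, \<kappa>)) \<le> ?m * (4 * C * (1 + t\<^sup>2) powr (- \<alpha>))"
      by simp
    from R0 R1 show ?thesis ..
  qed
  then show "cmod (CLINT \<kappa>|lborel. f (\<delta>, \<kappa>) *\<^sub>R char_term t (\<delta>, \<kappa>)) \<le> ?m * (C * (1 + t\<^sup>2) powr (- \<alpha>))"
    "t * cmod (CLINT \<kappa>|lborel. f (\<delta>, \<kappa>) *\<^sub>R char_term_deriv t (\<delta>, \<kappa>)) \<le> ?m * (4 * C * (1 + t\<^sup>2) powr (- \<alpha>))"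
    by auto
qed

text \<open>Disintegrate along \<open>\<delta>\<close>: for almost every \<open>\<delta>\<close> the conditional bounds hold, and the marginal
density integrates to one.\<close>

lemma smooth_mix_terms:
  assumes H: "prob_space H"
    and supp: "AE p in H. u0 < fst p \<and> (snd p)\<^sup>2 \<le> A"
    and smooth: "smooth_mixing u0 \<sigma>0 \<alpha> C H" and t: "1 \<le> t" and C: "0 < C"
    and int: "integrable H (mix_term u0 \<sigma>0 t)" "integrable H (mix_term_deriv u0 \<sigma>0 t)"
  shows "cmod (CLINT p|H. mix_term u0 \<sigma>0 t p) \<le> C * (1 + t\<^sup>2) powr (- \<alpha>)"
    and "t * cmod (CLINT p|H. mix_term_deriv u0 \<sigma>0 t p) \<le> 4 * C * (1 + t\<^sup>2) powr (- \<alpha>)"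
proof -
  interpret H: prob_space H by (rule H)
  let ?N = "(lborel :: real measure) \<Otimes>\<^sub>M (lborel :: real measure)"
  let ?X = "\<lambda>(u, \<sigma>). (u - u0, (\<sigma>\<^sup>2 - \<sigma>0\<^sup>2) / 2) :: real \<times> real"
  obtain f where f[measurable]: "f \<in> borel_measurable ?N" and f0: "\<And>p. 0 \<le> f p"
    and dist: "distributed H ?N ?X (\<lambda>p. ennreal (f p))"
    and FT: "\<And>\<delta> t. 0 < marginal_density f \<delta> \<Longrightarrow>
           cmod (cond_FT f \<delta> t) \<le> C * (1 + \<bar>t\<bar>) powr (- \<alpha>) \<and>
                (\<exists>D. (cond_FT f \<delta> has_vector_derivative D) (at t) \<and>
                     cmod D \<le> C * (1 + \<bar>t\<bar>) powr (- (\<alpha> + 1)))"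
    using smooth unfolding smooth_mixing_def by blast
  have X[measurable]: "?X \<in> measurable H ?N" using dist by (simp add: distributed_def)
  have dd: "distr H ?N ?X = density ?N (\<lambda>p. ennreal (f p))" using dist by (simp add: distributed_def)
  have transfer: "integrable ?N (\<lambda>q. f q *\<^sub>R g q) \<and> (CLINT p|H. g (?X p)) = (CLINT q|?N. f q *\<^sub>R g q)"
    if g[measurable]: "g \<in> borel_measurable ?N" and gi: "integrable H (\<lambda>p. g (?X p))" for g :: "real \<times> real \<Rightarrow> complex"
    using integrable_distr_eq[OF X g] integral_distr[OF X g] gi f0
    unfolding dd by (simp add: integrable_density integral_density)
  have fint: "integrable ?N f" and f1: "(LINT q|?N. f q) = 1"
  proof -
    have "(\<integral>\<^sup>+q. ennreal (f q) \<partial>?N) = emeasure (density ?N (\<lambda>p. ennreal (f p))) (space ?N)"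
      by (subst emeasure_density[OF _ sets.top]) (auto intro!: nn_integral_cong)
    also have "\<dots> = 1"
      using prob_space.emeasure_space_1[OF H.prob_space_distr[OF X]] unfolding dd space_density .
    finally have *: "(\<integral>\<^sup>+q. ennreal (f q) \<partial>?N) = ennreal 1" by simp
    then show fint: "integrable ?N f" using f0 by (intro integrableI_nonneg) auto
    show "(LINT q|?N. f q) = 1" using * nn_integral_eq_integral[OF fint] f0
      by (simp add: Bochner_Integration.integral_nonneg)
  qed
  define K where "K = A + \<sigma>0\<^sup>2"
  have suppf: "AE q in ?N. 0 < f q \<longrightarrow> 0 < fst q \<and> \<bar>snd q\<bar> \<le> K"
  proof -
    have "AE p in H. 0 < fst (?X p) \<and> \<bar>snd (?X p)\<bar> \<le> K"
      using supp
    proof eventually_elim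
      case (elim p)
      have "\<bar>(snd p)\<^sup>2 - \<sigma>0\<^sup>2\<bar> \<le> A + \<sigma>0\<^sup>2"
        using elim zero_le_power2[of "snd p"] zero_le_power2[of \<sigma>0] unfolding abs_le_iff by linarith
      moreover have "\<bar>((snd p)\<^sup>2 - \<sigma>0\<^sup>2) / 2\<bar> \<le> \<bar>(snd p)\<^sup>2 - \<sigma>0\<^sup>2\<bar>" by simp
      ultimately have "\<bar>((snd p)\<^sup>2 - \<sigma>0\<^sup>2) / 2\<bar> \<le> A + \<sigma>0\<^sup>2" by (rule order_trans[rotated])
      with elim show ?case by (simp add: K_def split_beta')
    qed
    note 1 = this
    have m: "fst \<in> borel_measurable ?N" "snd \<in> borel_measurable ?N"
      using measurable_fst[of "lborel :: real measure" "lborel :: real measure"] measurable_snd[of "lborel :: real measure" "lborel :: real measure"] by simp_all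
    have 2: "Measurable.pred ?N (\<lambda>q. 0 < fst q \<and> \<bar>snd q\<bar> \<le> K)"
      unfolding pred_def
    proof (rule sets.sets_Collect_conj)
      show "{q \<in> space ?N. 0 < fst q} \<in> sets ?N"
        by (rule borel_measurable_less[OF borel_measurable_const m(1)])
      show "{q \<in> space ?N. \<bar>snd q\<bar> \<le> K} \<in> sets ?N"
        by (rule borel_measurable_le[OF borel_measurable_abs[OF m(2)] borel_measurable_const])
    qed
    show ?thesis using H.distributed_AE2[OF dist 2] 1 by (simp add: ennreal_less_zero_iff)
  qed
  have supp': "AE \<delta> in lborel. AE \<kappa> in lborel. 0 < f (\<delta>, \<kappa>) \<longrightarrow> 0 < \<delta> \<and> \<bar>\<kappa>\<bar> \<le> K"
    using lborel_pair.AE_pair[OF suppf] by simp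
  have fint': "AE \<delta> in lborel. integrable lborel (\<lambda>\<kappa>. f (\<delta>, \<kappa>))" by (rule lborel_pair.AE_integrable_fst'[OF fint])
  have mint: "integrable lborel (marginal_density f)" and m1: "(LINT \<delta>|lborel. marginal_density f \<delta>) = 1"
    using lborel_pair.integrable_fst'[OF fint] lborel_pair.integral_fst'[OF fint] f1 by (simp_all add: marginal_density_def[abs_def])
  have final: "cmod (CLINT p|H. g (?X p)) \<le> B"
    if g: "g \<in> borel_measurable ?N" "integrable H (\<lambda>p. g (?X p))"
      and b: "AE \<delta> in lborel. cmod (CLINT \<kappa>|lborel. f (\<delta>, \<kappa>) *\<^sub>R g (\<delta>, \<kappa>)) \<le> marginal_density f \<delta> * B" for g B
  proof -
    note tr = transfer[OF g]
    have "(CLINT p|H. g (?X p)) = (CLINT \<delta>|lborel. CLINT \<kappa>|lborel. f (\<delta>, \<kappa>) *\<^sub>R g (\<delta>, \<kappa>))"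
      using tr lborel_pair.integral_fst'[OF conjunct1[OF tr]] by simp
    also have "cmod \<dots> \<le> (LINT \<delta>|lborel. cmod (CLINT \<kappa>|lborel. f (\<delta>, \<kappa>) *\<^sub>R g (\<delta>, \<kappa>)))"
      by (rule integral_norm_bound)
    also have "\<dots> \<le> (LINT \<delta>|lborel. marginal_density f \<delta> * B)"
      using lborel_pair.integrable_fst'[OF conjunct1[OF tr]] mint b
      by (intro integral_mono_AE integrable_norm integrable_mult_left) auto
    finally show ?thesis using m1 by simp
  qed
  have Fm: "char_term t \<in> borel_measurable ?N" "char_term_deriv t \<in> borel_measurable ?N"
    unfolding char_term_def[abs_def] char_term_deriv_def[abs_def] by measurable
  have e0: "char_term t (?X p) = mix_term u0 \<sigma>0 t p" for p
    by (simp add: char_term_def mix_term_def split_beta')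
  have e1: "char_term_deriv t (?X p) = mix_term_deriv u0 \<sigma>0 t p" for p
    by (simp add: char_term_deriv_def mix_term_deriv_def e0) (simp add: split_beta')
  show "cmod (CLINT p|H. mix_term u0 \<sigma>0 t p) \<le> C * (1 + t\<^sup>2) powr (- \<alpha>)"
    using int(1) unfolding e0[symmetric]
  proof (rule final[OF Fm(1)])
    show "AE \<delta> in lborel. cmod (CLINT \<kappa>|lborel. f (\<delta>, \<kappa>) *\<^sub>R char_term t (\<delta>, \<kappa>)) \<le> marginal_density f \<delta> * (C * (1 + t\<^sup>2) powr - \<alpha>)"
      using supp' fint'
    proof eventually_elim
      case (elim \<delta>)
      show ?case by (rule conditional_char_terms(1)[OF f0 elim(2) elim(1) FT t C])
    qed
  qed
  have "cmod (CLINT p|H. mix_term_deriv u0 \<sigma>0 t p) \<le> 4 * C * (1 + t\<^sup>2) powr (- \<alpha>) / t"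
    using int(2) unfolding e1[symmetric]
  proof (rule final[OF Fm(2)])
    show "AE \<delta> in lborel. cmod (CLINT \<kappa>|lborel. f (\<delta>, \<kappa>) *\<^sub>R char_term_deriv t (\<delta>, \<kappa>)) \<le> marginal_density f \<delta> * (4 * C * (1 + t\<^sup>2) powr - \<alpha> / t)"
      using supp' fint'
    proof eventually_elim
      case (elim \<delta>)
      show ?case using conditional_char_terms(2)[OF f0 elim(2) elim(1) FT t C] t by (simp add: field_simps)
    qed
  qed
  then show "t * cmod (CLINT p|H. mix_term_deriv u0 \<sigma>0 t p) \<le> 4 * C * (1 + t\<^sup>2) powr (- \<alpha>)"
    using t by (simp add: field_simps)
qed

section \<open>Uniform rate and consistency\<close>

text \<open>Write \<open>w = n\<^bsup>A\<gamma>-1\<^esup>\<close>, so that \<open>w/\<epsilon>\<^sup>2 \<le> 1\<close>. The null component contributes \<open>w/\<epsilon>\<^sup>2\<close> times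
\<open>exp(-(A - \<sigma>0\<^sup>2)t\<^sup>2)\<close>. The wide components contribute \<open>w/\<epsilon>\<close>, which is at most \<open>\<surd>w\<close> because
\<open>(w/\<epsilon>)\<^sup>2 = w (w/\<epsilon>\<^sup>2)\<close>. Both are Gaussian in \<open>t\<close>, that is, powers of \<open>n\<close>, and the remaining
factors are only \<open>exp(O(t))\<close>.\<close>

lemma moment_bound_ratio_le:
  fixes n :: nat
  assumes n: "2 \<le> n" and t: "t = freq \<gamma> n" and \<gamma>: "0 < \<gamma>" "A * \<gamma> < 1"
    and A: "\<sigma>0\<^sup>2 < A" and \<epsilon>: "0 < \<epsilon>" and b: "real n powr (A * \<gamma> - 1) / \<epsilon>\<^sup>2 \<le> 1"
  shows "moment_bound \<sigma>0 A t \<epsilon> / (real n * \<epsilon>\<^sup>2)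
    \<le> (8 + 2 * t\<^sup>2 * \<sigma>0 ^ 4) * exp ((2 * t + 1) * A) * (exp (- ((A - \<sigma>0\<^sup>2) * t\<^sup>2)) + exp (- ((1 / \<gamma> - A) / 2 * t\<^sup>2)))"
proof -
  have t0: "0 \<le> t" using n \<gamma> by (simp add: t freq_def)
  have t2: "t\<^sup>2 = \<gamma> * ln (real n)" using n \<gamma> by (simp add: t freq_def)
  define w where "w = real n powr (A * \<gamma> - 1)"
  have w0: "0 < w" using n by (simp add: w_def)
  have wn: "w * real n = exp (A * t\<^sup>2)"
  proof -
    have "w * real n = real n powr (A * \<gamma>)"
      using powr_add[of "real n" "A * \<gamma> - 1" 1] n by (simp add: w_def)
    then show ?thesis using n by (simp add: t2 powr_def algebra_simps)
  qed
  \<comment> \<open>Since \<open>t\<^sup>2 = \<gamma> log n\<close>, powers of \<open>n\<close> and Gaussian factors in \<open>t\<close> are interchangeable.\<close>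
  have wexp: "w = exp (- ((1 / \<gamma> - A) * t\<^sup>2))"
    using n \<gamma> by (simp add: w_def powr_def t2 field_simps)
  have we: "w / \<epsilon>\<^sup>2 \<le> 1" using b by (simp add: w_def)
  have sw: "w / \<epsilon> \<le> exp (- ((1 / \<gamma> - A) / 2 * t\<^sup>2))"
  proof (rule power2_le_imp_le)
    have "(w / \<epsilon>)\<^sup>2 = w * (w / \<epsilon>\<^sup>2)" by (simp add: power2_eq_square)
    also have "\<dots> \<le> w * 1" using we w0 by (intro mult_left_mono) auto
    also have "\<dots> = (exp (- ((1 / \<gamma> - A) / 2 * t\<^sup>2)))\<^sup>2"
      unfolding wexp by (simp add: exp_double[symmetric] field_simps)
    finally show "(w / \<epsilon>)\<^sup>2 \<le> (exp (- ((1 / \<gamma> - A) / 2 * t\<^sup>2)))\<^sup>2" .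
  qed simp
  have n0: "real n = exp (A * t\<^sup>2) / w" using wn w0 by (simp add: field_simps)
  have X: "exp ((t + 1)\<^sup>2 * B) / real n = exp ((2 * t + 1) * B) * exp (- ((A - B) * t\<^sup>2)) * w" for B
  proof -
    have "exp ((t + 1)\<^sup>2 * B) = exp ((2 * t + 1) * B) * exp (- ((A - B) * t\<^sup>2)) * exp (A * t\<^sup>2)"
      unfolding exp_add[symmetric] by (rule arg_cong[where f=exp]) (simp add: power2_eq_square algebra_simps)
    then show ?thesis unfolding n0 by simp
  qed
  have eA: "exp ((2 * t + 1) * \<sigma>0\<^sup>2) \<le> exp ((2 * t + 1) * A)" using A t0 by (auto intro: mult_left_mono)
  have 1: "exp ((t + 1)\<^sup>2 * \<sigma>0\<^sup>2) / (real n * \<epsilon>\<^sup>2) \<le> exp ((2 * t + 1) * A) * exp (- ((A - \<sigma>0\<^sup>2) * t\<^sup>2))"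
  proof -
    have "exp ((t + 1)\<^sup>2 * \<sigma>0\<^sup>2) / (real n * \<epsilon>\<^sup>2) = exp ((2 * t + 1) * \<sigma>0\<^sup>2) * exp (- ((A - \<sigma>0\<^sup>2) * t\<^sup>2)) * (w / \<epsilon>\<^sup>2)"
      using X[of "\<sigma>0\<^sup>2"] by (simp add: divide_divide_eq_left[symmetric])
    also have "\<dots> \<le> exp ((2 * t + 1) * A) * exp (- ((A - \<sigma>0\<^sup>2) * t\<^sup>2)) * 1"
      using eA we w0 by (intro mult_mono) auto
    finally show ?thesis by simp
  qed
  have 2: "\<epsilon> * exp ((t + 1)\<^sup>2 * A) / (real n * \<epsilon>\<^sup>2) \<le> exp ((2 * t + 1) * A) * exp (- ((1 / \<gamma> - A) / 2 * t\<^sup>2))"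
  proof -
    have "\<epsilon> * exp ((t + 1)\<^sup>2 * A) / (real n * \<epsilon>\<^sup>2) = (exp ((t + 1)\<^sup>2 * A) / real n) / \<epsilon>"
      using \<epsilon> by (simp add: power2_eq_square)
    also have "\<dots> = exp ((2 * t + 1) * A) * (w / \<epsilon>)" unfolding X by simp
    also have "\<dots> \<le> exp ((2 * t + 1) * A) * exp (- ((1 / \<gamma> - A) / 2 * t\<^sup>2))" by (rule mult_left_mono[OF sw]) simp
    finally show ?thesis .
  qed
  have "moment_bound \<sigma>0 A t \<epsilon> / (real n * \<epsilon>\<^sup>2) = (8 + 2 * t\<^sup>2 * \<sigma>0 ^ 4) *
     (exp ((t + 1)\<^sup>2 * \<sigma>0\<^sup>2) / (real n * \<epsilon>\<^sup>2) + \<epsilon> * exp ((t + 1)\<^sup>2 * A) / (real n * \<epsilon>\<^sup>2))"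
    unfolding moment_bound_def by (simp only: add_divide_distrib[symmetric] times_divide_eq_right)
  also have "\<dots> \<le> (8 + 2 * t\<^sup>2 * \<sigma>0 ^ 4) * (exp ((2 * t + 1) * A) * exp (- ((A - \<sigma>0\<^sup>2) * t\<^sup>2))
      + exp ((2 * t + 1) * A) * exp (- ((1 / \<gamma> - A) / 2 * t\<^sup>2)))"
    using 1 2 by (intro mult_left_mono add_mono add_nonneg_nonneg) auto
  finally show ?thesis by (simp add: algebra_simps)
qed

lemma gaussian_decay_beats_polynomial:
  fixes A c s :: real
  assumes "0 < c" "0 < s" "0 < A"
  shows "((\<lambda>t. (1 + t\<^sup>2) * ((8 + 2 * t\<^sup>2 * s) * exp ((2 * t + 1) * A) * exp (- (c * t\<^sup>2)))) \<longlongrightarrow> 0) at_top"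
  using assms by real_asymp

lemma filterlim_freq: "0 < \<gamma> \<Longrightarrow> filterlim (freq \<gamma>) at_top sequentially"
  unfolding freq_def by real_asymp

theorem theorem3p2:
  fixes \<epsilon>0 u0 A \<sigma>0 \<gamma> c0 \<alpha> C \<eta> :: real
    and b \<delta> :: "nat \<Rightarrow> real"
    and u0_hat sigma0sq_hat :: "nat \<Rightarrow> (nat \<Rightarrow> real) \<Rightarrow> real"
  assumes "0 < \<epsilon>0" "\<epsilon>0 < 1/2"
    and "0 < A" "0 < \<sigma>0" "\<sigma>0\<^sup>2 < A"
    and "0 < \<gamma>" "\<gamma> < 1 / A"
    and "\<And>n. 0 < b n" "b \<longlonglongrightarrow> 0"
    and "\<And>n. 0 < \<delta> n" "1 < c0"
    and "liminf (\<lambda>n. ereal (\<delta> n * freq \<gamma> n / (sqrt 2 * ln (freq \<gamma> n)))) \<ge> ereal (c0 + 1)"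
    and "0 < \<alpha>" "0 < C"
    and "\<And>n. u0_hat n \<in> borel_measurable (\<Pi>\<^sub>M j\<in>{1..n}. borel)"
    and "\<And>n. sigma0sq_hat n \<in> borel_measurable (\<Pi>\<^sub>M j\<in>{1..n}. borel)"
    and "\<And>n x. 2 \<le> n \<Longrightarrow> x \<in> space (\<Pi>\<^sub>M j\<in>{1..n}. (borel :: real measure)) \<Longrightarrow>
           gen_ecf n x (freq \<gamma> n) \<noteq> 0 \<Longrightarrow>
           u0_hat n x = u0_fun (gen_ecf n x) (freq \<gamma> n)"
    and "\<And>n x. 2 \<le> n \<Longrightarrow> x \<in> space (\<Pi>\<^sub>M j\<in>{1..n}. (borel :: real measure)) \<Longrightarrow>
           gen_ecf n x (freq \<gamma> n) \<noteq> 0 \<Longrightarrow>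
           sigma0sq_hat n x = sigma0sq_fun (gen_ecf n x) (freq \<gamma> n)"
    and "0 < \<eta>"
  shows "(\<lambda>n. SUP (\<epsilon>, H) \<in> param_class \<epsilon>0 u0 A \<sigma>0 \<gamma> b \<delta> \<alpha> C n.
            emeasure (sample_law u0 \<sigma>0 n \<epsilon> H)
              {x \<in> space (sample_law u0 \<sigma>0 n \<epsilon> H).
                 cmod (eps_fun (gen_ecf n x) (freq \<gamma> n) (u0_hat n x) (sigma0sq_hat n x)
                         / complex_of_real \<epsilon> - 1) > \<eta>})
         \<longlonglongrightarrow> 0"
proof -
  let ?t = "freq \<gamma>"
  \<comment> \<open>The factor 38 is the amplification in the deterministic estimate.\<close>
  define \<theta> where "\<theta> = min (1/16) (\<eta> / 38)"
  have \<theta>: "0 < \<theta>" "\<theta> \<le> 1/16" "38 * \<theta> \<le> \<eta>" using \<open>0 < \<eta>\<close> by (auto simp: \<theta>_def)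
  have A\<gamma>: "A * \<gamma> < 1" using assms(3,7) by (simp add: field_simps)
  have A1: "0 < 1 / \<gamma> - A" using A\<gamma> \<open>0 < \<gamma>\<close> by (simp add: field_simps)
  note t_inf = filterlim_freq[OF \<open>0 < \<gamma>\<close>]
  \<comment> \<open>Midway between 2 and \<open>c0 + 1\<close>: above 2, so that \<open>t\<^sup>2 t\<^bsup>-c1\<^esup>\<close> vanishes, and strictly below the limit inferior.\<close>
  define c1 where "c1 = (c0 + 3) / 2"
  have c1: "2 < c1" "c1 < c0 + 1" using \<open>1 < c0\<close> by (auto simp: c1_def)

  define r where "r t = (1 + t\<^sup>2) * ((8 + 2 * t\<^sup>2 * \<sigma>0 ^ 4) * exp ((2 * t + 1) * A) * exp (- ((A - \<sigma>0\<^sup>2) * t\<^sup>2))) / \<theta>\<^sup>2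
     + (1 + t\<^sup>2) * ((8 + 2 * t\<^sup>2 * \<sigma>0 ^ 4) * exp ((2 * t + 1) * A) * exp (- ((1 / \<gamma> - A) / 2 * t\<^sup>2))) / \<theta>\<^sup>2" for t :: real
  have r0: "((\<lambda>n. r (?t n)) \<longlongrightarrow> 0) sequentially"
  proof (rule filterlim_compose[OF _ t_inf])
    have "(r \<longlongrightarrow> 0 / \<theta>\<^sup>2 + 0 / \<theta>\<^sup>2) at_top"
      unfolding r_def using assms(3-5) A1 \<theta>
      by (intro tendsto_add tendsto_divide tendsto_const gaussian_decay_beats_polynomial) auto
    then show "(r \<longlongrightarrow> 0) at_top" by simp
  qed

  have small: "eventually (\<lambda>n. P (?t n)) sequentially" if "eventually P at_top" for P
    using t_inf that by (rule eventually_compose_filterlim[rotated])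
  have ev_le: "eventually (\<lambda>x. g x \<le> \<theta>) at_top" if "(g \<longlongrightarrow> 0) at_top" for g :: "real \<Rightarrow> real"
    using order_tendstoD(2)[OF that \<theta>(1)] by eventually_elim simp
  have "eventually (\<lambda>n. ?t n \<ge> 2 \<and> ?t n powr (- c1) \<le> \<theta>
      \<and> 2 * ?t n powr (- (sqrt 2 * c1 / 5)) + (?t n)\<^sup>2 * (A + \<sigma>0\<^sup>2) * ?t n powr (- c1) \<le> \<theta>
      \<and> C * (1 + (?t n)\<^sup>2) powr (- \<alpha>) \<le> \<theta> \<and> 4 * C * (1 + (?t n)\<^sup>2) powr (- \<alpha>) \<le> \<theta>) sequentially"
  proof (intro small eventually_conj eventually_ge_at_top ev_le)
    show "((\<lambda>x. x powr - c1) \<longlongrightarrow> 0) at_top" using c1 by real_asymp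
    show "((\<lambda>x. 2 * x powr - (sqrt 2 * c1 / 5) + x\<^sup>2 * (A + \<sigma>0\<^sup>2) * x powr - c1) \<longlongrightarrow> 0) at_top"
    proof -
      have "((\<lambda>x. x powr - (sqrt 2 * c1 / 5)) \<longlongrightarrow> 0) at_top" using c1 by (intro tendsto_neg_powr filterlim_ident) auto
      moreover have "((\<lambda>x. x\<^sup>2 * x powr - c1) \<longlongrightarrow> 0) at_top" using c1 by real_asymp
      ultimately have "((\<lambda>x. 2 * x powr - (sqrt 2 * c1 / 5) + (A + \<sigma>0\<^sup>2) * (x\<^sup>2 * x powr - c1)) \<longlongrightarrow> 2 * 0 + (A + \<sigma>0\<^sup>2) * 0) at_top"
        by (intro tendsto_add tendsto_mult tendsto_const)
      then show ?thesis by (simp add: mult_ac)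
    qed
    show "((\<lambda>x. C * (1 + x\<^sup>2) powr - \<alpha>) \<longlongrightarrow> 0) at_top" using \<open>0 < \<alpha>\<close> \<open>0 < C\<close> by real_asymp
    show "((\<lambda>x. 4 * C * (1 + x\<^sup>2) powr - \<alpha>) \<longlongrightarrow> 0) at_top" using \<open>0 < \<alpha>\<close> \<open>0 < C\<close> by real_asymp
  qed
  moreover have "eventually (\<lambda>n. ereal c1 < ereal (\<delta> n * ?t n / (sqrt 2 * ln (?t n)))) sequentially"
    by (rule less_LiminfD, rule less_le_trans[OF _ assms(12)]) (use c1(2) in simp)
  moreover have "eventually (\<lambda>n. b n < 1) sequentially" using assms(9) by (rule order_tendstoD) simp
  moreover have "eventually (\<lambda>n. 2 \<le> n) sequentially" by (rule eventually_ge_at_top)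
  ultimately have upper: "eventually (\<lambda>n. (SUP (\<epsilon>, H) \<in> param_class \<epsilon>0 u0 A \<sigma>0 \<gamma> b \<delta> \<alpha> C n.
            emeasure (sample_law u0 \<sigma>0 n \<epsilon> H)
              {x \<in> space (sample_law u0 \<sigma>0 n \<epsilon> H).
                 cmod (eps_fun (gen_ecf n x) (freq \<gamma> n) (u0_hat n x) (sigma0sq_hat n x)
                         / complex_of_real \<epsilon> - 1) > \<eta>}) \<le> ennreal (r (?t n))) sequentially"
  proof eventually_elim
    case (elim n)
    define t where "t = ?t n"
    have t: "2 \<le> t" and small_b: "t powr (- c1) \<le> \<theta>" "2 * t powr (- (sqrt 2 * c1 / 5)) + t\<^sup>2 * (A + \<sigma>0\<^sup>2) * t powr (- c1) \<le> \<theta>"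
      and small_c: "C * (1 + t\<^sup>2) powr (- \<alpha>) \<le> \<theta>" "4 * C * (1 + t\<^sup>2) powr (- \<alpha>) \<le> \<theta>"
      and sep: "c1 < \<delta> n * t / (sqrt 2 * ln t)"
      using elim by (auto simp: t_def)
    \<comment> \<open>The separation hypothesis in the form \<open>exp(-t\<delta>\<^sub>n/\<surd>2) \<le> t\<^bsup>-c1\<^esup>\<close>.\<close>
    have td: "sqrt 2 * c1 * ln t \<le> t * \<delta> n"
    proof -
      have "0 < sqrt 2 * ln t" using t by simp
      then show ?thesis using sep by (simp add: less_divide_eq mult_ac)
    qed
    show ?case
    proof (rule SUP_least, clarify)
      fix \<epsilon> H assume p: "(\<epsilon>, H) \<in> param_class \<epsilon>0 u0 A \<sigma>0 \<gamma> b \<delta> \<alpha> C n"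
      then have \<epsilon>: "0 < \<epsilon>" "\<epsilon> < 1/2" using assms(2) by (auto simp: param_class_def)
      have H: "prob_space H" "sets H = sets borel" "AE p in H. 0 < snd p"
        using p by (auto simp: param_class_def mixing_distribution_def)
      interpret H: prob_space H by (rule H(1))
      have sH[measurable_cong]: "sets H = sets (borel \<Otimes>\<^sub>M borel)" by (simp only: H(2) borel_prod)
      have "\<P>(p in H. fst p > u0 \<and> (snd p)\<^sup>2 \<le> A) = 1" using p by (auto simp: param_class_def)
      then have supp: "AE p in H. u0 < fst p \<and> (snd p)\<^sup>2 \<le> A" by (subst (asm) H.prob_Collect_eq_1) measurable
      have "real n powr (A * \<gamma> - 1) / \<epsilon>\<^sup>2 \<le> b n" using p by (auto simp: param_class_def)
      then have nb: "real n powr (A * \<gamma> - 1) / \<epsilon>\<^sup>2 \<le> 1" using elim by linarith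
      have t1: "1 \<le> t" using t by simp
      note int = integrable_mix_terms[OF H supp \<epsilon> t1 \<open>0 < \<sigma>0\<close>]
      have "cmod (CLINT p|H. mix_term u0 \<sigma>0 t p) \<le> \<theta> \<and> t * cmod (CLINT p|H. mix_term_deriv u0 \<sigma>0 t p) \<le> \<theta>"
      proof (cases "smooth_mixing u0 \<sigma>0 \<alpha> C H")
        case True
        note sm = smooth_mix_terms[OF H(1) supp True t1 \<open>0 < C\<close> int]
        show ?thesis using sm small_c by (auto intro: order_trans)
      next
        case False
        then have "\<P>(p in H. fst p > u0 + \<delta> n) = 1" using p by (auto simp: param_class_def)
        then have sepH: "AE p in H. u0 + \<delta> n < fst p" by (subst (asm) H.prob_Collect_eq_1) measurable
        have d0: "0 \<le> \<delta> n" using assms(10)[of n] by simp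
        note sb = separated_mix_terms[OF H(1) supp sepH d0 t1, of \<sigma>0]
        have "- (t * \<delta> n) / sqrt 2 \<le> - c1 * ln t" using td by (simp add: field_simps)
        then have e1: "exp (- (t * \<delta> n) / sqrt 2) \<le> t powr (- c1)" using t by (simp add: powr_def)
        have "- (t * \<delta> n) / 5 \<le> - (sqrt 2 * c1 / 5) * ln t" using td by (simp add: field_simps)
        then have e2: "exp (- (t * \<delta> n) / 5) \<le> t powr (- (sqrt 2 * c1 / 5))" using t by (simp add: powr_def)
        have "2 * exp (- (t * \<delta> n) / 5) + t\<^sup>2 * (A + \<sigma>0\<^sup>2) * exp (- (t * \<delta> n) / sqrt 2)
            \<le> 2 * t powr (- (sqrt 2 * c1 / 5)) + t\<^sup>2 * (A + \<sigma>0\<^sup>2) * t powr (- c1)"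
          using e1 e2 assms(3) by (intro add_mono mult_left_mono) auto
        then show ?thesis
          using order_trans[OF sb(1) order_trans[OF e1 small_b(1)]] order_trans[OF sb(2) order_trans[OF _ small_b(2)]] by blast
      qed
      then have m: "cmod (CLINT p|H. mix_term u0 \<sigma>0 t p) \<le> \<theta>" "t * cmod (CLINT p|H. mix_term_deriv u0 \<sigma>0 t p) \<le> \<theta>" by auto
      have "emeasure (sample_law u0 \<sigma>0 n \<epsilon> H)
              {x \<in> space (sample_law u0 \<sigma>0 n \<epsilon> H).
                 cmod (eps_fun (gen_ecf n x) t (u0_hat n x) (sigma0sq_hat n x) / complex_of_real \<epsilon> - 1) > \<eta>}
          \<le> ennreal ((1 + t\<^sup>2) * moment_bound \<sigma>0 A t \<epsilon> / (real n * (\<theta> * \<epsilon>)\<^sup>2))"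
      proof (rule emeasure_bad_sample_le[OF H supp \<epsilon> t1 \<open>0 < \<sigma>0\<close> _ \<theta> m])
        show "0 < n" using elim by simp
        show "u0_hat n x = u0_fun (gen_ecf n x) t"
          if "x \<in> space (\<Pi>\<^sub>M j\<in>{1..n}. (borel :: real measure))" "gen_ecf n x t \<noteq> 0" for x
          using assms(17)[of n x] that elim unfolding t_def by blast
        show "sigma0sq_hat n x = sigma0sq_fun (gen_ecf n x) t"
          if "x \<in> space (\<Pi>\<^sub>M j\<in>{1..n}. (borel :: real measure))" "gen_ecf n x t \<noteq> 0" for x
          using assms(18)[of n x] that elim unfolding t_def by blast
      qed
      also have "\<dots> \<le> ennreal (r t)"
      proof (rule ennreal_leI)
        have "(1 + t\<^sup>2) * moment_bound \<sigma>0 A t \<epsilon> / (real n * (\<theta> * \<epsilon>)\<^sup>2) = (1 + t\<^sup>2) * (moment_bound \<sigma>0 A t \<epsilon> / (real n * \<epsilon>\<^sup>2)) / \<theta>\<^sup>2"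
          by (simp add: power_mult_distrib mult_ac)
        also have "\<dots> \<le> (1 + t\<^sup>2) * ((8 + 2 * t\<^sup>2 * \<sigma>0 ^ 4) * exp ((2 * t + 1) * A) * (exp (- ((A - \<sigma>0\<^sup>2) * t\<^sup>2)) + exp (- ((1 / \<gamma> - A) / 2 * t\<^sup>2)))) / \<theta>\<^sup>2"
          using elim by (intro divide_right_mono mult_left_mono moment_bound_ratio_le[OF _ t_def assms(6) A\<gamma> assms(5) \<epsilon>(1) nb]) auto
        also have "\<dots> = r t" by (simp only: r_def distrib_left add_divide_distrib)
        finally show "(1 + t\<^sup>2) * moment_bound \<sigma>0 A t \<epsilon> / (real n * (\<theta> * \<epsilon>)\<^sup>2) \<le> r t" .
      qed
      finally show "emeasure (sample_law u0 \<sigma>0 n \<epsilon> H)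
              {x \<in> space (sample_law u0 \<sigma>0 n \<epsilon> H).
                 cmod (eps_fun (gen_ecf n x) (freq \<gamma> n) (u0_hat n x) (sigma0sq_hat n x) / complex_of_real \<epsilon> - 1) > \<eta>}
          \<le> ennreal (r (?t n))" by (simp add: t_def)
    qed
  qed
  have lim: "((\<lambda>n. ennreal (r (?t n))) \<longlongrightarrow> 0) sequentially"
    using tendsto_ennrealI[OF r0] by simp
  show ?thesis
    by (rule tendsto_sandwich[OF _ upper tendsto_const lim], rule always_eventually, rule allI, rule zero_le)
qed

end
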